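(* Let $G$ be a Polish group and $X$ a point transitive $G$-flow. Suppose $x\in X$ has comeager orbit and that the universal minimal flow $M(H)$ of $H:=\mathrm{Stab}(x)$ has a comeager orbit. Then $\mathrm{Proj}_G(X)\simeq \mathrm{Sa}(G/H^* )$, where $H^*\le H$ is an extremely amenable closed subgroup such that $M(H)\simeq \mathrm{Sa}(H/H^* )$ (as $H$-flows).
   Context: All topological spaces are Hausdorff. A $G$-flow is a (nonempty) compact Hausdorff space with a continuous left action of $G$; a $G$-map is a continuous $G$-equivariant map; an extension is a surjective $G$-map; $\simeq$ denotes isomorphism of flows. A subflow is a nonempty closed invariant subset. A flow is point transitive if it has a point with dense orbit, and minimal if every orbit is dense. $M(H)$ is the universal minimal flow of $H$: the (unique up to isomorphism) minimal $H$-flow which maps onto every minimal $H$-flow. A group is extremely amenable if every flow of it has a fixed point. By a known theorem of Zucker, if $H$ is Polish and $M(H)$ has a comeager orbit, then $M(H)\simeq\mathrm{Sa}(H/H^* )$ for some extremely amenable closed subgroup $H^*\le H$. An extension $\phi\colon X\to Y$ of $G$-flows is $G$-irreducible if $\phi(Z)\neq Y$ for every proper subflow $Z\subsetneq X$. The $G$-projective cover $\mathrm{Proj}_G(X)$ of a $G$-flow $X$ is the (existing and unique up to isomorphism) $G$-flow $Y$ with a $G$-irreducible extension $\phi\colon Y\to X$ such that for every $G$-irreducible extension $\pi\colon Z\to X$ there is a $G$-map $\psi\colon Y\to Z$ with $\pi\circ\psi=\phi$. For a closed subgroup $H$ of a topological group $G$, $\mathrm{Sa}(G/H)$ is the Samuel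 compactification of $G/H$: the Gelfand spectrum of the unital commutative $C^*$-algebra of bounded functions $f\colon G/H\to\mathbb{C}$ such that for every $\varepsilon>0$ there is an open neighbourhood $U$ of $1_G$ with $|f(ux)-f(x)|<\varepsilon$ for all $u\in U$, $x\in G/H$. It is a $G$-flow (with the action induced by translation) containing $G/H$ as a dense $G$-invariant subset. *)

theory Defs
  imports "HOL-Analysis.Analysis" "HOL-Algebra.Group_Action" "HOL-Algebra.Left_Coset"
begin

no_notation eq_closure_of (\<open>closure'_of\<index>\<close>)

section \<open>Topological groups and flows\<close>

locale topological_group = group G for G (structure) and T :: "'g topology" +
  assumes topspace_eq_carrier: "topspace T = carrier G"
    and continuous_mult: "continuous_map (prod_topology T T) T (\<lambda>(g, h). g \<otimes> h)"
    and continuous_inv: "continuous_map T T (\<lambda>g. inv g)"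

locale polish_group = topological_group G T for G (structure) and T +
  assumes completely_metrizable: "completely_metrizable_space T"
    and separable: "separable_space T"

text \<open>
  A topological group is a pair \<open>G\<close>, \<open>T\<close>. A subgroup \<open>H\<close> of it is the pair
  \<open>G\<lparr>carrier := H\<rparr>\<close>, \<open>subtopology T H\<close>. A flow is a pair \<open>X\<close>, \<open>\<alpha>\<close> of a topology
  and an action on its underlying set.
\<close>

definition flow ::
    "('g, 'b) monoid_scheme \<Rightarrow> 'g topology \<Rightarrow> 'x topology \<Rightarrow> ('g \<Rightarrow> 'x \<Rightarrow> 'x) \<Rightarrow> bool"
  where "flow G T X \<alpha> \<longleftrightarrow>
    topspace X \<noteq> {} \<and> compact_space X \<and> Hausdorff_space X \<and>
    group_action G (topspace X) \<alpha> \<and>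
    continuous_map (prod_topology T X) X (\<lambda>(g, x). \<alpha> g x)"

definition subflow ::
    "('g, 'b) monoid_scheme \<Rightarrow> 'x topology \<Rightarrow> ('g \<Rightarrow> 'x \<Rightarrow> 'x) \<Rightarrow> 'x set \<Rightarrow> bool"
  where "subflow G X \<alpha> Z \<longleftrightarrow>
    Z \<noteq> {} \<and> closedin X Z \<and> (\<forall>g\<in>carrier G. \<forall>z\<in>Z. \<alpha> g z \<in> Z)"

definition equivariant_map ::
    "('g, 'b) monoid_scheme \<Rightarrow> 'x topology \<Rightarrow> ('g \<Rightarrow> 'x \<Rightarrow> 'x) \<Rightarrow>
     'y topology \<Rightarrow> ('g \<Rightarrow> 'y \<Rightarrow> 'y) \<Rightarrow> ('x \<Rightarrow> 'y) \<Rightarrow> bool"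
  where "equivariant_map G X \<alpha> Y \<beta> f \<longleftrightarrow>
    continuous_map X Y f \<and> (\<forall>g\<in>carrier G. \<forall>x\<in>topspace X. f (\<alpha> g x) = \<beta> g (f x))"

definition extension ::
    "('g, 'b) monoid_scheme \<Rightarrow> 'x topology \<Rightarrow> ('g \<Rightarrow> 'x \<Rightarrow> 'x) \<Rightarrow>
     'y topology \<Rightarrow> ('g \<Rightarrow> 'y \<Rightarrow> 'y) \<Rightarrow> ('x \<Rightarrow> 'y) \<Rightarrow> bool"
  where "extension G X \<alpha> Y \<beta> f \<longleftrightarrow>
    equivariant_map G X \<alpha> Y \<beta> f \<and> f ` topspace X = topspace Y"

definition flow_isomorphic ::
    "('g, 'b) monoid_scheme \<Rightarrow> 'x topology \<Rightarrow> ('g \<Rightarrow> 'x \<Rightarrow> 'x) \<Rightarrow>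
     'y topology \<Rightarrow> ('g \<Rightarrow> 'y \<Rightarrow> 'y) \<Rightarrow> bool"
  where "flow_isomorphic G X \<alpha> Y \<beta> \<longleftrightarrow>
    (\<exists>f. homeomorphic_map X Y f \<and> equivariant_map G X \<alpha> Y \<beta> f)"

definition point_transitive ::
    "('g, 'b) monoid_scheme \<Rightarrow> 'x topology \<Rightarrow> ('g \<Rightarrow> 'x \<Rightarrow> 'x) \<Rightarrow> bool"
  where "point_transitive G X \<alpha> \<longleftrightarrow>
    (\<exists>x\<in>topspace X. X closure_of (orbit G \<alpha> x) = topspace X)"

definition minimal_flow ::
    "('g, 'b) monoid_scheme \<Rightarrow> 'g topology \<Rightarrow> 'x topology \<Rightarrow> ('g \<Rightarrow> 'x \<Rightarrow> 'x) \<Rightarrow> bool"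
  where "minimal_flow G T X \<alpha> \<longleftrightarrow>
    flow G T X \<alpha> \<and> (\<forall>x\<in>topspace X. X closure_of (orbit G \<alpha> x) = topspace X)"

definition meager_in :: "'x topology \<Rightarrow> 'x set \<Rightarrow> bool"
  where "meager_in X S \<longleftrightarrow>
    (\<exists>\<N>. countable \<N> \<and> (\<forall>N\<in>\<N>. N \<subseteq> topspace X \<and> X interior_of (X closure_of N) = {}) \<and>
         S = \<Union>\<N>)"

definition comeager_in :: "'x topology \<Rightarrow> 'x set \<Rightarrow> bool"
  where "comeager_in X S \<longleftrightarrow> S \<subseteq> topspace X \<and> meager_in X (topspace X - S)"

section \<open>Notions quantifying over all flows\<close>

text \<open>
  A definition cannot quantify over types, so "every flow" is rendered as "every flow carried by a
  subset of one sufficiently large type". A Hausdorff space with a dense subset \<open>D\<close> embeds into the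
  power set of the power set of \<open>D\<close>. Orbit closures of a group on the type \<open>'g\<close>, in
  particular its minimal flows, therefore live on \<open>'g set set\<close>, and the irreducible extensions of a
  flow on \<open>'x\<close> live on \<open>('g \<times> 'x) set set\<close>. The last section proves that the definitions below
  imply their versions for flows on arbitrary types.
\<close>

definition universal_minimal_flow ::
    "('g, 'b) monoid_scheme \<Rightarrow> 'g topology \<Rightarrow> 'm topology \<Rightarrow> ('g \<Rightarrow> 'm \<Rightarrow> 'm) \<Rightarrow> bool"
  where "universal_minimal_flow G T M \<mu> \<longleftrightarrow>
    minimal_flow G T M \<mu> \<and>
    (\<forall>(N :: 'g set set topology) \<nu>. minimal_flow G T N \<nu> \<longrightarrow> (\<exists>f. extension G M \<mu> N \<nu> f))"

definition extremely_amenable :: "('g, 'b) monoid_scheme \<Rightarrow> 'g topology \<Rightarrow> bool"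
  where "extremely_amenable G T \<longleftrightarrow>
    (\<forall>(N :: 'g set set topology) \<nu>. flow G T N \<nu> \<longrightarrow>
       (\<exists>p\<in>topspace N. \<forall>g\<in>carrier G. \<nu> g p = p))"

definition irreducible_extension ::
    "('g, 'b) monoid_scheme \<Rightarrow> 'x topology \<Rightarrow> ('g \<Rightarrow> 'x \<Rightarrow> 'x) \<Rightarrow>
     'y topology \<Rightarrow> ('g \<Rightarrow> 'y \<Rightarrow> 'y) \<Rightarrow> ('x \<Rightarrow> 'y) \<Rightarrow> bool"
  where "irreducible_extension G X \<alpha> Y \<beta> f \<longleftrightarrow>
    extension G X \<alpha> Y \<beta> f \<and>
    (\<forall>Z. subflow G X \<alpha> Z \<and> Z \<noteq> topspace X \<longrightarrow> f ` Z \<noteq> topspace Y)"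

definition projective_cover_map ::
    "('g, 'b) monoid_scheme \<Rightarrow> 'g topology \<Rightarrow> 'y topology \<Rightarrow> ('g \<Rightarrow> 'y \<Rightarrow> 'y) \<Rightarrow>
     'x topology \<Rightarrow> ('g \<Rightarrow> 'x \<Rightarrow> 'x) \<Rightarrow> ('y \<Rightarrow> 'x) \<Rightarrow> bool"
  where "projective_cover_map G T Y \<beta> X \<alpha> \<phi> \<longleftrightarrow>
    irreducible_extension G Y \<beta> X \<alpha> \<phi> \<and>
    (\<forall>(Z :: ('g \<times> 'x) set set topology) \<gamma> \<pi>.
       flow G T Z \<gamma> \<and> irreducible_extension G Z \<gamma> X \<alpha> \<pi> \<longrightarrow>
       (\<exists>\<psi>. equivariant_map G Y \<beta> Z \<gamma> \<psi> \<and> (\<forall>y\<in>topspace Y. \<pi> (\<psi> y) = \<phi> y)))"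

definition projective_cover ::
    "('g, 'b) monoid_scheme \<Rightarrow> 'g topology \<Rightarrow> 'y topology \<Rightarrow> ('g \<Rightarrow> 'y \<Rightarrow> 'y) \<Rightarrow>
     'x topology \<Rightarrow> ('g \<Rightarrow> 'x \<Rightarrow> 'x) \<Rightarrow> bool"
  where "projective_cover G T Y \<beta> X \<alpha> \<longleftrightarrow>
    flow G T Y \<beta> \<and> (\<exists>\<phi>. projective_cover_map G T Y \<beta> X \<alpha> \<phi>)"

section \<open>The Samuel compactification of a coset space\<close>

text \<open>
  Functions on \<open>G/H\<close> and functionals on the algebra are extensional (equal to \<open>undefined\<close> off
  their domain), so that equality of functions is equality on the domain.
\<close>

definition samuel_algebra ::
    "('g, 'b) monoid_scheme \<Rightarrow> 'g topology \<Rightarrow> 'g set \<Rightarrow> ('g set \<Rightarrow> complex) set"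
  where "samuel_algebra G T H =
    {f \<in> extensional (lcosets\<^bsub>G\<^esub> H).
       bounded (f ` (lcosets\<^bsub>G\<^esub> H)) \<and>
       (\<forall>\<epsilon>>0. \<exists>U. openin T U \<and> \<one>\<^bsub>G\<^esub> \<in> U \<and>
          (\<forall>u\<in>U. \<forall>c\<in>lcosets\<^bsub>G\<^esub> H. cmod (f (u <#\<^bsub>G\<^esub> c) - f c) < \<epsilon>))}"

text \<open>
  The Gelfand spectrum: nonzero multiplicative linear functionals, with the topology of pointwise
  convergence on the algebra. Continuity and compatibility with conjugation are automatic for such
  functionals on a \<open>C\<^sup>*\<close>-algebra.
\<close>

definition samuel_points ::
    "('g, 'b) monoid_scheme \<Rightarrow> 'g topology \<Rightarrow> 'g set \<Rightarrow> (('g set \<Rightarrow> complex) \<Rightarrow> complex) set"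
  where "samuel_points G T H =
    {\<xi> \<in> extensional (samuel_algebra G T H).
       (\<exists>f\<in>samuel_algebra G T H. \<xi> f \<noteq> 0) \<and>
       (\<forall>f\<in>samuel_algebra G T H. \<forall>f'\<in>samuel_algebra G T H.
          \<xi> (\<lambda>c\<in>lcosets\<^bsub>G\<^esub> H. f c + f' c) = \<xi> f + \<xi> f' \<and>
          \<xi> (\<lambda>c\<in>lcosets\<^bsub>G\<^esub> H. f c * f' c) = \<xi> f * \<xi> f') \<and>
       (\<forall>a. \<forall>f\<in>samuel_algebra G T H. \<xi> (\<lambda>c\<in>lcosets\<^bsub>G\<^esub> H. a * f c) = a * \<xi> f)}"

definition samuel ::
    "('g, 'b) monoid_scheme \<Rightarrow> 'g topology \<Rightarrow> 'g set \<Rightarrow> (('g set \<Rightarrow> complex) \<Rightarrow> complex) topology"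
  where "samuel G T H =
    subtopology (product_topology (\<lambda>_. euclidean) (samuel_algebra G T H)) (samuel_points G T H)"

text \<open>
  The action sends evaluation at \<open>c\<close> to evaluation at \<open>g c\<close>, hence extends the
  translation action on \<open>G/H\<close>.
\<close>

definition samuel_act ::
    "('g, 'b) monoid_scheme \<Rightarrow> 'g topology \<Rightarrow> 'g set \<Rightarrow>
     'g \<Rightarrow> (('g set \<Rightarrow> complex) \<Rightarrow> complex) \<Rightarrow> (('g set \<Rightarrow> complex) \<Rightarrow> complex)"
  where "samuel_act G T H g =
    (\<lambda>\<xi>\<in>samuel_points G T H. \<lambda>f\<in>samuel_algebra G T H. \<xi> (\<lambda>c\<in>lcosets\<^bsub>G\<^esub> H. f (g <#\<^bsub>G\<^esub> c)))"

section \<open>Flows on arbitrary types\<close>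

text \<open>
  Every flow with a dense subset that injects into \<open>'u\<close> has an isomorphic copy on \<open>'u set set\<close>.
\<close>

lemma flow_copy:
  fixes Z :: "'z topology" and i :: "'z \<Rightarrow> 'u"
  assumes flow: "flow G T Z \<gamma>" and D: "D \<subseteq> topspace Z" "Z closure_of D = topspace Z"
    and i: "inj_on i D"
  obtains W :: "'u set set topology" and \<delta> h k where
    "flow G T W \<delta>" "homeomorphic_maps Z W h k"
    "equivariant_map G Z \<gamma> W \<delta> h" "equivariant_map G W \<delta> Z \<gamma> k"
proof -
  have cZ: "compact_space Z" and hZ: "Hausdorff_space Z" and nZ: "topspace Z \<noteq> {}"
    and cont: "continuous_map (prod_topology T Z) Z (\<lambda>(g, x). \<gamma> g x)"
    using flow by (auto simp: flow_def)
  interpret ga: group_action G "topspace Z" \<gamma>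
    using flow by (simp add: flow_def)
  interpret group G
    using ga.group_hom by (rule group_hom.axioms(1))
  have act_in: "\<gamma> g z \<in> topspace Z" if "g \<in> carrier G" "z \<in> topspace Z" for g z
    using ga.element_image that by blast
  define e where "e z = {i ` A | A. A \<subseteq> D \<and> z \<in> Z closure_of A}" for z
  have inj: "inj_on e (topspace Z)"
  proof (rule inj_onI, rule ccontr)
    fix z w assume z: "z \<in> topspace Z" and w: "w \<in> topspace Z" and eq: "e z = e w" and "z \<noteq> w"
    then obtain U V where UV: "openin Z U" "openin Z V" "z \<in> U" "w \<in> V" "disjnt U V"
      using hZ unfolding Hausdorff_space_def by metis
    have "z \<in> Z closure_of (U \<inter> D)"
    proof (clarsimp simp: in_closure_of z)
      fix S assume "z \<in> S" "openin Z S"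
      then have "openin Z (S \<inter> U)" "S \<inter> U \<noteq> {}" using UV by auto
      then have "D \<inter> (S \<inter> U) \<noteq> {}" using D(2) dense_intersects_open by metis
      then show "\<exists>y. y \<in> U \<and> y \<in> D \<and> y \<in> S" by auto
    qed
    then have "i ` (U \<inter> D) \<in> e w"
      unfolding eq [symmetric] by (auto simp: e_def)
    then obtain A where A: "A \<subseteq> D" "w \<in> Z closure_of A" "i ` (U \<inter> D) = i ` A"
      by (auto simp: e_def)
    have "A = U \<inter> D"
      using i A by (metis inf_le2 inj_on_image_eq_iff)
    then have "A \<inter> V = {}" using UV(5) by (auto simp: disjnt_def)
    then show False
      using A(2) UV(2,4) by (auto simp: in_closure_of)
  qed
  define k where "k = inv_into (topspace Z) e"
  define W where "W = pullback_topology (e ` topspace Z) k Z"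
  have ke: "k (e z) = z" if "z \<in> topspace Z" for z
    using inj that by (simp add: k_def)
  have tW: "topspace W = e ` topspace Z"
    unfolding W_def topspace_pullback_topology using ke by auto
  have ek: "e (k w) = w" and kin: "k w \<in> topspace Z" if "w \<in> topspace W" for w
    using that ke by (auto simp: tW)
  have contk: "continuous_map W Z k"
    using continuous_map_pullback [of Z Z id] unfolding W_def by (simp add: comp_def)
  have conte: "continuous_map Z W e"
    unfolding W_def
  proof (rule continuous_map_pullback')
    show "continuous_map Z Z (k \<circ> e)"
      by (rule continuous_map_eq [of _ _ id]) (auto simp: ke)
    show "topspace Z \<subseteq> e -` e ` topspace Z" by auto
  qed
  have hm: "homeomorphic_maps Z W e k"
    by (simp add: homeomorphic_maps_def conte contk ke ek)
  then have hs: "Z homeomorphic_space W"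
    using homeomorphic_space_def by blast
  define \<delta> where "\<delta> g = (\<lambda>w\<in>topspace W. e (\<gamma> g (k w)))" for g
  have \<delta>_in: "\<delta> g w \<in> topspace W" if "g \<in> carrier G" "w \<in> topspace W" for g w
    using that act_in kin by (auto simp: \<delta>_def tW)
  have \<delta>_mult: "\<delta> (g \<otimes>\<^bsub>G\<^esub> g') w = \<delta> g (\<delta> g' w)"
    if "g \<in> carrier G" "g' \<in> carrier G" "w \<in> topspace W" for g g' w
    using that \<delta>_in [of g' w] by (simp add: \<delta>_def kin ke act_in ga.composition_rule)
  have \<delta>_one: "\<delta> \<one>\<^bsub>G\<^esub> w = w" if "w \<in> topspace W" for w
  proof -
    have "\<gamma> \<one>\<^bsub>G\<^esub> (k w) = k w"
      using ga.id_eq_one kin [OF that] by (metis restrict_apply')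
    then show ?thesis using that by (simp add: \<delta>_def ek)
  qed
  have \<delta>_bij: "\<delta> g \<in> Bij (topspace W)" if g: "g \<in> carrier G" for g
  proof -
    have "bij_betw (\<delta> g) (topspace W) (topspace W)"
    proof (rule bij_betw_byWitness [where f' = "\<delta> (inv\<^bsub>G\<^esub> g)"])
      show "\<forall>a\<in>topspace W. \<delta> (inv\<^bsub>G\<^esub> g) (\<delta> g a) = a"
        using g by (simp add: \<delta>_mult [symmetric] \<delta>_one)
      show "\<forall>a\<in>topspace W. \<delta> g (\<delta> (inv\<^bsub>G\<^esub> g) a) = a"
        using g by (simp add: \<delta>_mult [symmetric] \<delta>_one)
    qed (use g \<delta>_in in auto)
    then show ?thesis
      by (simp add: Bij_def \<delta>_def)
  qed
  have "\<delta> \<in> hom G (BijGroup (topspace W))"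
  proof (rule homI)
    fix g g' assume g: "g \<in> carrier G" "g' \<in> carrier G"
    have "\<delta> (g \<otimes>\<^bsub>G\<^esub> g') = compose (topspace W) (\<delta> g) (\<delta> g')"
    proof
      fix w show "\<delta> (g \<otimes>\<^bsub>G\<^esub> g') w = compose (topspace W) (\<delta> g) (\<delta> g') w"
      proof (cases "w \<in> topspace W")
        case True
        then show ?thesis using g by (simp add: \<delta>_mult compose_eq)
      next
        case False
        then show ?thesis by (simp add: \<delta>_def compose_def)
      qed
    qed
    then show "\<delta> (g \<otimes>\<^bsub>G\<^esub> g') = \<delta> g \<otimes>\<^bsub>BijGroup (topspace W)\<^esub> \<delta> g'"
      using g by (simp add: BijGroup_def \<delta>_bij)
  qed (simp add: BijGroup_def \<delta>_bij)
  then have gaW: "group_action G (topspace W) \<delta>"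
    by (simp add: group_action_def group_hom_def group_hom_axioms_def group_BijGroup
        group_axioms)
  have "continuous_map (prod_topology T W) (prod_topology T Z) (\<lambda>(g, w). (g, k w))"
    using continuous_map_prod_top [of T W T Z id k] contk by (simp add: id_def)
  then have "continuous_map (prod_topology T W) Z ((\<lambda>(g, x). \<gamma> g x) \<circ> (\<lambda>(g, w). (g, k w)))"
    by (rule continuous_map_compose [OF _ cont])
  then have "continuous_map (prod_topology T W) W
      (e \<circ> ((\<lambda>(g, x). \<gamma> g x) \<circ> (\<lambda>(g, w). (g, k w))))"
    by (rule continuous_map_compose [OF _ conte])
  then have contW: "continuous_map (prod_topology T W) W (\<lambda>(g, w). \<delta> g w)"
    by (rule continuous_map_eq) (auto simp: \<delta>_def)
  have "flow G T W \<delta>"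
    unfolding flow_def using gaW contW nZ cZ hZ tW
      homeomorphic_compact_space [OF hs] homeomorphic_Hausdorff_space [OF hs] by simp
  from this hm show thesis
  proof (rule that)
    show "equivariant_map G Z \<gamma> W \<delta> e"
      using conte by (simp add: equivariant_map_def \<delta>_def tW ke)
    show "equivariant_map G W \<delta> Z \<gamma> k"
      using contk by (simp add: equivariant_map_def \<delta>_def kin ke act_in)
  qed
qed

lemma equivariant_map_compose:
  assumes "equivariant_map G X \<alpha> Y \<beta> f" "equivariant_map G Y \<beta> Z \<gamma> h"
  shows "equivariant_map G X \<alpha> Z \<gamma> (h \<circ> f)"
proof -
  have "f x \<in> topspace Y" if "x \<in> topspace X" for x
    using assms(1) that by (auto simp: equivariant_map_def dest: continuous_map_funspace)
  then show ?thesis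
    using assms continuous_map_compose [of X Y f Z h] by (simp add: equivariant_map_def)
qed

lemma extension_compose:
  assumes "extension G X \<alpha> Y \<beta> f" "extension G Y \<beta> Z \<gamma> h"
  shows "extension G X \<alpha> Z \<gamma> (h \<circ> f)"
  using assms equivariant_map_compose [of G X \<alpha> Y \<beta> f Z \<gamma> h]
  by (auto simp: extension_def simp flip: image_image [of h f])

lemma closure_invariant:
  assumes flow: "flow G T Z \<gamma>" and G: "topspace T = carrier G"
    and D: "D \<subseteq> topspace Z" "\<And>g z. g \<in> carrier G \<Longrightarrow> z \<in> D \<Longrightarrow> \<gamma> g z \<in> D"
    and "D \<noteq> {}"
  shows "subflow G Z \<gamma> (Z closure_of D)"
  unfolding subflow_def
proof (intro conjI ballI)
  show "Z closure_of D \<noteq> {}"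
    using closure_of_subset [OF D(1)] \<open>D \<noteq> {}\<close> by auto
  fix g z assume g: "g \<in> carrier G" and z: "z \<in> Z closure_of D"
  have cont: "continuous_map (prod_topology T Z) Z (\<lambda>(g, x). \<gamma> g x)"
    using flow by (simp add: flow_def)
  have "continuous_map Z (prod_topology T Z) (\<lambda>z. (g, z))"
    using g G by (intro continuous_map_pairedI) auto
  from continuous_map_compose [OF this cont] have "continuous_map Z Z (\<gamma> g)"
    by (simp add: comp_def)
  then have "\<gamma> g ` (Z closure_of D) \<subseteq> Z closure_of (\<gamma> g ` D)"
    by (rule continuous_map_image_closure_subset)
  also have "\<dots> \<subseteq> Z closure_of D"
    using D(2) g by (intro closure_of_mono) auto
  finally show "\<gamma> g z \<in> Z closure_of D"
    using z by auto
qed auto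

lemma orbit_invariant:
  assumes "flow G T Z \<gamma>" "z \<in> topspace Z"
  shows "orbit G \<gamma> z \<subseteq> topspace Z" "z \<in> orbit G \<gamma> z"
    "g \<in> carrier G \<Longrightarrow> y \<in> orbit G \<gamma> z \<Longrightarrow> \<gamma> g y \<in> orbit G \<gamma> z"
proof -
  interpret ga: group_action G "topspace Z" \<gamma>
    using assms by (simp add: flow_def)
  interpret group G
    using ga.group_hom by (rule group_hom.axioms(1))
  show "orbit G \<gamma> z \<subseteq> topspace Z" "z \<in> orbit G \<gamma> z"
    using ga.element_image assms(2) ga.orbit_refl by (auto simp: orbit_def)
  assume g: "g \<in> carrier G" and "y \<in> orbit G \<gamma> z"
  then obtain g' where "g' \<in> carrier G" "y = \<gamma> g' z"
    by (auto simp: orbit_def)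
  then have "\<gamma> g y = \<gamma> (g \<otimes>\<^bsub>G\<^esub> g') z" "g \<otimes>\<^bsub>G\<^esub> g' \<in> carrier G"
    using g assms(2) ga.composition_rule [of z g g'] by (simp_all add: m_closed)
  then show "\<gamma> g y \<in> orbit G \<gamma> z"
    by (auto simp: orbit_def)
qed

lemma inj_on_orbit: "\<exists>i :: 'z \<Rightarrow> 'g. inj_on i (orbit (G :: ('g, 'b) monoid_scheme) \<gamma> z)"
proof -
  have "orbit G \<gamma> z = (\<lambda>g. \<gamma> g z) ` carrier G"
    by (auto simp: orbit_def)
  then show ?thesis
    using inj_on_inv_into [of "orbit G \<gamma> z" "\<lambda>g. \<gamma> g z" "carrier G"] by auto
qed

text \<open>A universal minimal flow maps onto every minimal flow, whatever its type.\<close>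

proposition universal_minimal_flowD:
  fixes N :: "'n topology"
  assumes M: "universal_minimal_flow G T M \<mu>" and N: "minimal_flow G T N \<nu>"
  shows "\<exists>f. extension G M \<mu> N \<nu> f"
proof -
  have fN: "flow G T N \<nu>" using N by (simp add: minimal_flow_def)
  then obtain n where n: "n \<in> topspace N" unfolding flow_def by blast
  obtain i :: "'n \<Rightarrow> 'a" where i: "inj_on i (orbit G \<nu> n)"
    using inj_on_orbit [of G \<nu> n] by blast
  have dense: "N closure_of (orbit G \<nu> n) = topspace N"
    using N n by (simp add: minimal_flow_def)
  obtain W :: "'a set set topology" and \<delta> h k where W: "flow G T W \<delta>"
    and hk: "homeomorphic_maps N W h k"
    and h: "equivariant_map G N \<nu> W \<delta> h" and k: "equivariant_map G W \<delta> N \<nu> k"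
    by (rule flow_copy [OF fN orbit_invariant(1) [OF fN n] dense i])
  have hom: "homeomorphic_map N W h" "homeomorphic_map W N k"
    using hk homeomorphic_maps_map by blast+
  have "W closure_of (orbit G \<delta> w) = topspace W" if w: "w \<in> topspace W" for w
  proof -
    have kw: "k w \<in> topspace N" "h (k w) = w"
      using hk w by (auto simp: homeomorphic_maps_def dest: continuous_map_funspace)
    have "orbit G \<delta> w = h ` orbit G \<nu> (k w)"
      using h kw by (auto simp: orbit_def equivariant_map_def image_def)
    then have "W closure_of (orbit G \<delta> w) = h ` (N closure_of (orbit G \<nu> (k w)))"
      using homeomorphic_map_closure_of [OF hom(1)] orbit_invariant(1) [OF fN kw(1)] by metis
    also have "\<dots> = topspace W"
      using N kw hom(1) by (simp add: minimal_flow_def homeomorphic_imp_surjective_map)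
    finally show ?thesis .
  qed
  then have "minimal_flow G T W \<delta>" using W by (simp add: minimal_flow_def)
  then obtain f where f: "extension G M \<mu> W \<delta> f"
    using M by (auto simp: universal_minimal_flow_def)
  have "extension G W \<delta> N \<nu> k"
    using k hom(2) by (simp add: extension_def homeomorphic_imp_surjective_map)
  then show ?thesis
    using extension_compose [OF f] by blast
qed

text \<open>A flow of an extremely amenable group has a fixed point, whatever its type.\<close>

proposition extremely_amenableD:
  fixes N :: "'n topology"
  assumes ea: "extremely_amenable G T" and G: "topspace T = carrier G" and fN: "flow G T N \<nu>"
  shows "\<exists>p\<in>topspace N. \<forall>g\<in>carrier G. \<nu> g p = p"
proof -
  obtain n where n: "n \<in> topspace N" using fN unfolding flow_def by blast
  note orb = orbit_invariant [OF fN n]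
  interpret ga: group_action G "topspace N" \<nu>
    using fN by (simp add: flow_def)
  interpret group G
    using ga.group_hom by (rule group_hom.axioms(1))
  define C where "C = N closure_of (orbit G \<nu> n)"
  have C: "subflow G N \<nu> C"
    unfolding C_def using closure_invariant [OF fN G orb(1) orb(3)] orb(2) by blast
  have CN: "C \<subseteq> topspace N" by (simp add: C_def closure_of_subset_topspace)
  have orbC: "orbit G \<nu> n \<subseteq> C" unfolding C_def by (rule closure_of_subset [OF orb(1)])
  define S where "S = subtopology N C"
  have tS: "topspace S = C" using CN by (auto simp: S_def)
  define \<sigma> where "\<sigma> g = restrict (\<nu> g) C" for g
  have inC: "\<nu> g z \<in> C" if "g \<in> carrier G" "z \<in> C" for g z
    using C that by (simp add: subflow_def)
  have "\<sigma> \<in> hom G (BijGroup C)"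
  proof -
    have bij: "\<sigma> g \<in> Bij C" if g: "g \<in> carrier G" for g
    proof -
      have inv: "inv\<^bsub>G\<^esub> g \<in> carrier G" using g by simp
      have "bij_betw (\<nu> g) C C"
      proof (rule bij_betw_byWitness [where f' = "\<nu> (inv\<^bsub>G\<^esub> g)"])
        show "\<forall>a\<in>C. \<nu> (inv\<^bsub>G\<^esub> g) (\<nu> g a) = a"
          using g CN ga.orbit_sym_aux by blast
        show "\<forall>a\<in>C. \<nu> g (\<nu> (inv\<^bsub>G\<^esub> g) a) = a"
          using ga.orbit_sym_aux [OF inv] g CN
          by (metis inv_inv subsetD)
      qed (use inC [OF g] inC [OF inv] in blast)+
      then have "bij_betw (\<sigma> g) C C"
        unfolding \<sigma>_def by (simp add: bij_betw_cong [of C "restrict (\<nu> g) C" "\<nu> g"])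
      then show ?thesis by (simp add: Bij_def \<sigma>_def)
    qed
    show ?thesis
    proof (rule homI)
      fix g g' assume g: "g \<in> carrier G" "g' \<in> carrier G"
      have "\<sigma> (g \<otimes>\<^bsub>G\<^esub> g') = compose C (\<sigma> g) (\<sigma> g')"
        using g inC CN by (auto simp: \<sigma>_def compose_def fun_eq_iff ga.composition_rule subset_iff)
      then show "\<sigma> (g \<otimes>\<^bsub>G\<^esub> g') = \<sigma> g \<otimes>\<^bsub>BijGroup C\<^esub> \<sigma> g'"
        using g bij by (simp add: BijGroup_def)
    qed (simp add: BijGroup_def bij)
  qed
  then have gaC: "group_action G (topspace S) \<sigma>"
    by (simp add: tS group_action_def group_hom_def group_hom_axioms_def group_BijGroup
        group_axioms)
  have "compact_space S"
    using fN C unfolding S_def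
    by (auto simp: flow_def subflow_def intro!: compact_space_subtopology closedin_compact_space)
  moreover have "Hausdorff_space S"
    using fN by (simp add: S_def flow_def Hausdorff_space_subtopology)
  moreover have "continuous_map (prod_topology T S) S (\<lambda>(g, x). \<sigma> g x)"
  proof -
    have "continuous_map (prod_topology T N) N (\<lambda>(g, x). \<nu> g x)"
      using fN by (simp add: flow_def)
    then have "continuous_map (prod_topology T S) N (\<lambda>(g, x). \<nu> g x)"
      unfolding S_def by (simp add: prod_topology_subtopology(2) continuous_map_from_subtopology)
    then have "continuous_map (prod_topology T S) N (\<lambda>(g, x). \<sigma> g x)"
      by (rule continuous_map_eq) (auto simp: \<sigma>_def tS)
    moreover have "(\<lambda>(g, x). \<sigma> g x) ` topspace (prod_topology T S) \<subseteq> C"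
      using inC tS G by (auto simp: \<sigma>_def)
    ultimately have "continuous_map (prod_topology T S) (subtopology N C) (\<lambda>(g, x). \<sigma> g x)"
      by (auto simp: continuous_map_in_subtopology)
    then show ?thesis
      by (simp add: S_def)
  qed
  ultimately have fS: "flow G T S \<sigma>"
    using gaC C by (simp add: flow_def tS subflow_def)
  obtain i :: "'n \<Rightarrow> 'a" where i: "inj_on i (orbit G \<nu> n)"
    using inj_on_orbit [of G \<nu> n] by blast
  have denseS: "S closure_of (orbit G \<nu> n) = topspace S"
    using orbC by (simp add: S_def closure_of_subtopology_open C_def closure_of_subset_topspace
        inf_absorb1 inf_absorb2)
  have orbS: "orbit G \<nu> n \<subseteq> topspace S"
    using orbC by (simp add: tS)
  obtain W :: "'a set set topology" and \<delta> h k where W: "flow G T W \<delta>"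
    and "homeomorphic_maps S W h k" "equivariant_map G S \<sigma> W \<delta> h"
    and k: "equivariant_map G W \<delta> S \<sigma> k"
    by (rule flow_copy [OF fS orbS denseS i])
  obtain p where p: "p \<in> topspace W" "\<forall>g\<in>carrier G. \<delta> g p = p"
    using ea W unfolding extremely_amenable_def by blast
  have kp: "k p \<in> C"
    using k p tS by (auto simp: equivariant_map_def dest: continuous_map_funspace)
  have "\<nu> g (k p) = k p" if "g \<in> carrier G" for g
  proof -
    have "k (\<delta> g p) = \<sigma> g (k p)"
      using k p(1) that by (simp add: equivariant_map_def)
    then show ?thesis using p(2) that kp by (simp add: \<sigma>_def)
  qed
  then show ?thesis using kp CN by auto
qed

text \<open>A projective cover maps to every irreducible extension, whatever its type.\<close>

proposition projective_cover_mapD: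
  fixes Z :: "'z topology" and X :: "'x topology" and G :: "('g, 'b) monoid_scheme"
  assumes cov: "projective_cover_map G T Y \<beta> X \<alpha> \<phi>"
    and G: "topspace T = carrier G"
    and fZ: "flow G T Z \<gamma>" and \<pi>: "irreducible_extension G Z \<gamma> X \<alpha> \<pi>"
  shows "\<exists>\<psi>. equivariant_map G Y \<beta> Z \<gamma> \<psi> \<and> (\<forall>y\<in>topspace Y. \<pi> (\<psi> y) = \<phi> y)"
proof -
  interpret ga: group_action G "topspace Z" \<gamma>
    using fZ by (simp add: flow_def)
  have ext: "extension G Z \<gamma> X \<alpha> \<pi>" and surj: "\<pi> ` topspace Z = topspace X"
    using \<pi> by (auto simp: irreducible_extension_def extension_def)
  define s where "s = inv_into (topspace Z) \<pi>"
  have s: "s a \<in> topspace Z" "\<pi> (s a) = a" if "a \<in> topspace X" for a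
    using that surj by (auto simp: s_def inv_into_into f_inv_into_f)
  define D where "D = (\<lambda>(g, a). \<gamma> g (s a)) ` (carrier G \<times> topspace X)"
  have D: "D = (\<Union>a\<in>topspace X. orbit G \<gamma> (s a))"
    by (auto simp: D_def orbit_def)
  have DZ: "D \<subseteq> topspace Z" and sD: "s ` topspace X \<subseteq> D"
    using orbit_invariant(1,2) [OF fZ s(1)] by (auto simp: D)
  have inv: "\<gamma> g z \<in> D" if "g \<in> carrier G" "z \<in> D" for g z
    using that orbit_invariant(3) [OF fZ s(1)] unfolding D by blast
  have "D \<noteq> {}" using sD surj fZ by (auto simp: flow_def)
  have dense: "Z closure_of D = topspace Z"
  proof (rule ccontr)
    assume ne: "Z closure_of D \<noteq> topspace Z"
    have sub: "subflow G Z \<gamma> (Z closure_of D)"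
      by (rule closure_invariant [OF fZ G DZ inv \<open>D \<noteq> {}\<close>])
    have "s ` topspace X \<subseteq> Z closure_of D"
      by (rule subset_trans [OF sD closure_of_subset [OF DZ]])
    then have "\<pi> ` s ` topspace X \<subseteq> \<pi> ` (Z closure_of D)"
      by (rule image_mono)
    moreover have "\<pi> ` s ` topspace X = topspace X"
      using s(2) by (simp add: image_image)
    moreover have "\<pi> ` (Z closure_of D) \<subseteq> topspace X"
      unfolding surj [symmetric] by (intro image_mono closure_of_subset_topspace)
    ultimately have "\<pi> ` (Z closure_of D) = topspace X"
      by simp
    then show False
      using \<pi> sub ne by (auto simp: irreducible_extension_def)
  qed
  have "inj_on (inv_into (carrier G \<times> topspace X) (\<lambda>(g, a). \<gamma> g (s a))) D"
    unfolding D_def by (rule inj_on_inv_into) auto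
  then obtain i :: "'z \<Rightarrow> 'g \<times> 'x" where i: "inj_on i D" by blast
  obtain W :: "('g \<times> 'x) set set topology" and \<delta> h k where W: "flow G T W \<delta>"
    and hk: "homeomorphic_maps Z W h k"
    and h: "equivariant_map G Z \<gamma> W \<delta> h" and k: "equivariant_map G W \<delta> Z \<gamma> k"
    by (rule flow_copy [OF fZ DZ dense i])
  have hom: "homeomorphic_map Z W h" "homeomorphic_map W Z k"
    using hk homeomorphic_maps_map by blast+
  have kh: "h (k w) = w" "k w \<in> topspace Z" if "w \<in> topspace W" for w
    using hk that by (auto simp: homeomorphic_maps_def dest: continuous_map_funspace)
  have kext: "extension G W \<delta> Z \<gamma> k"
    using k hom(2) by (simp add: extension_def homeomorphic_imp_surjective_map)
  have "irreducible_extension G W \<delta> X \<alpha> (\<pi> \<circ> k)"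
    unfolding irreducible_extension_def
  proof (intro conjI allI impI)
    show "extension G W \<delta> X \<alpha> (\<pi> \<circ> k)"
      by (rule extension_compose [OF kext ext])
    fix V assume V: "subflow G W \<delta> V \<and> V \<noteq> topspace W"
    have VW: "V \<subseteq> topspace W" using V closedin_subset by (auto simp: subflow_def)
    have "closedin Z (k ` V)"
      using V homeomorphic_map_closedness_eq [OF hom(2)] by (auto simp: subflow_def VW)
    moreover have "\<gamma> g z \<in> k ` V" if g: "g \<in> carrier G" and z: "z \<in> k ` V" for g z
    proof -
      obtain v where v: "v \<in> V" "z = k v" using z by blast
      then have "\<gamma> g z = k (\<delta> g v)" using k VW g by (auto simp: equivariant_map_def)
      moreover have "\<delta> g v \<in> V" using V v g by (simp add: subflow_def)
      ultimately show ?thesis by simp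
    qed
    ultimately have "subflow G Z \<gamma> (k ` V)"
      using V unfolding subflow_def by simp
    moreover have "k ` V \<noteq> topspace Z"
    proof
      assume "k ` V = topspace Z"
      then have "k ` V = k ` topspace W"
        using hom(2) by (simp add: homeomorphic_imp_surjective_map)
      then have "V = topspace W"
        using VW homeomorphic_imp_injective_map [OF hom(2)] inj_on_image_eq_iff by blast
      then show False using V by simp
    qed
    ultimately show "(\<pi> \<circ> k) ` V \<noteq> topspace X"
      using \<pi> unfolding irreducible_extension_def image_comp [symmetric] by blast
  qed
  then obtain \<psi> where "equivariant_map G Y \<beta> W \<delta> \<psi>" "\<forall>y\<in>topspace Y. (\<pi> \<circ> k) (\<psi> y) = \<phi> y"
    using cov W unfolding projective_cover_map_def by blast
  then show ?thesis
    using equivariant_map_compose [OF _ k] by (intro exI [of _ "k \<circ> \<psi>"]) auto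
qed

end

theory Submission
  imports Defs
begin

text \<open>
  Write \<open>Sa(G/K)\<close> for the Samuel compactification. The trivial coset gives a point of it, its
  base point, which is fixed by \<open>K\<close> and has a dense orbit. The base point is universal with
  this property: if \<open>K\<close> fixes a point \<open>n\<close> of a \<open>G\<close>-flow \<open>N\<close>, then exactly one \<open>G\<close>-map
  \<open>Sa(G/K) \<rightarrow> N\<close> sends the base point to \<open>n\<close> (\<open>samuel_universal\<close>, \<open>equivariant_map_determined\<close>).
  Let \<open>K\<close> be the extremely amenable subgroup of \<open>H = Stab(x)\<close>. As \<open>K\<close> fixes \<open>x\<close>, there is a \<open>G\<close>-map
  \<open>\<phi> : Sa(G/K) \<rightarrow> X\<close> with base point over \<open>x\<close>; it is the projective cover, for the following reasons.

  \<^emph>\<open>Irreducibility.\<close> A subflow \<open>Z\<close> with \<open>\<phi>(Z) = X\<close> meets the fibre over \<open>x\<close>. The orbit of \<open>x\<close> is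
  comeager and \<open>G\<close> is Polish, so by the theorem of Effros (\<open>orbit_map_open\<close>) every \<open>g x\<close> close to
  \<open>x\<close> is \<open>u x\<close> with \<open>u\<close> close to \<open>1\<close>; then \<open>g K = u h K\<close> with \<open>h \<in> H\<close>, and uniformly continuous
  functions hardly distinguish \<open>g K\<close> from \<open>h K\<close>. Hence the fibre lies in the closure of the
  \<open>H\<close>-orbit of the base point (\<open>orbit_fibre_subset_closure\<close>). This closure is a quotient of
  \<open>Sa(H/K) \<simeq> M(H)\<close>, so it is a minimal \<open>H\<close>-flow. Therefore \<open>Z\<close> contains the base point and is
  everything (\<open>irreducible_over_comeager_orbit\<close>).

  \<^emph>\<open>Projectivity.\<close> In any extension \<open>Z\<close> of \<open>X\<close> the fibre over \<open>x\<close> is a flow of \<open>K\<close>, so it has a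
  fixed point of \<open>K\<close>, and universality lifts \<open>\<phi>\<close> to \<open>Z\<close> (\<open>extension_lift\<close>).

  \<^emph>\<open>Uniqueness.\<close> Another projective cover \<open>Y\<close> has \<open>G\<close>-maps \<open>Sa(G/K) \<rightarrow> Y \<rightarrow> Sa(G/K)\<close> over \<open>X\<close>, both
  onto by irreducibility. It remains to see that every endomorphism \<open>\<eta>\<close> of \<open>Sa(G/K)\<close> over \<open>X\<close> is
  injective. As \<open>\<eta>\<close> is itself an extension, lifting the identity through it gives a right inverse,
  which is again an endomorphism over \<open>X\<close> and so has a right inverse too; hence \<open>\<eta>\<close> is bijective
  (\<open>irreducible_endomorphism_inj\<close>).
\<close>

section \<open>Topological groups and their flows\<close>

lemma continuous_map_euclideanI:
  fixes h :: "'a \<Rightarrow> 'b::metric_space"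
  assumes "\<And>x \<epsilon>. x \<in> topspace X \<Longrightarrow> 0 < \<epsilon> \<Longrightarrow>
    \<exists>W. openin X W \<and> x \<in> W \<and> (\<forall>y\<in>W. dist (h y) (h x) < \<epsilon>)"
  shows "continuous_map X euclidean h"
  unfolding continuous_map_def
proof (intro conjI allI impI)
  fix U :: "'b set" assume "openin euclidean U"
  show "openin X {x \<in> topspace X. h x \<in> U}"
  proof (subst openin_subopen, intro ballI)
    fix x assume "x \<in> {x \<in> topspace X. h x \<in> U}"
    then have x: "x \<in> topspace X" "h x \<in> U" by auto
    then obtain \<epsilon> where \<epsilon>: "0 < \<epsilon>" "\<And>z. dist z (h x) < \<epsilon> \<Longrightarrow> z \<in> U"
      using \<open>openin euclidean U\<close> by (auto simp: open_dist)
    obtain W where W: "openin X W" "x \<in> W" "\<forall>y\<in>W. dist (h y) (h x) < \<epsilon>"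
      using assms [OF x(1) \<epsilon>(1)] by blast
    then have "W \<subseteq> {x \<in> topspace X. h x \<in> U}"
      using \<epsilon>(2) openin_subset [OF W(1)] by auto
    with W(1,2) show "\<exists>V. openin X V \<and> x \<in> V \<and> V \<subseteq> {x \<in> topspace X. h x \<in> U}" by blast
  qed
qed auto

lemma (in group) group_actionI:
  assumes ext: "\<And>g. g \<in> carrier G \<Longrightarrow> a g \<in> extensional E"
    and closed: "\<And>g x. g \<in> carrier G \<Longrightarrow> x \<in> E \<Longrightarrow> a g x \<in> E"
    and one: "\<And>x. x \<in> E \<Longrightarrow> a \<one> x = x"
    and mult: "\<And>g h x. g \<in> carrier G \<Longrightarrow> h \<in> carrier G \<Longrightarrow> x \<in> E \<Longrightarrow> a (g \<otimes> h) x = a g (a h x)"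
  shows "group_action G E a"
proof -
  have bij: "a g \<in> Bij E" if g: "g \<in> carrier G" for g
  proof -
    have "bij_betw (a g) E E"
      by (rule bij_betw_byWitness [where f' = "a (inv g)"])
        (use g closed in \<open>auto simp: one simp flip: mult\<close>)
    then show ?thesis using ext [OF g] by (simp add: Bij_def)
  qed
  have "a \<in> hom G (BijGroup E)"
  proof (rule homI)
    fix g h assume gh: "g \<in> carrier G" "h \<in> carrier G"
    have "a (g \<otimes> h) = compose E (a g) (a h)"
      using gh ext [of "g \<otimes> h"] by (intro extensionalityI [of _ E]) (auto simp: compose_eq mult)
    then show "a (g \<otimes> h) = a g \<otimes>\<^bsub>BijGroup E\<^esub> a h"
      using gh by (simp add: BijGroup_def bij)
  qed (simp add: BijGroup_def bij)
  then show ?thesis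
    by (simp add: group_action_def group_hom_def group_hom_axioms_def group_BijGroup is_group)
qed

context topological_group
begin

lemma continuous_map_left_mult:
  assumes "g \<in> carrier G" shows "continuous_map T T (\<lambda>u. g \<otimes> u)"
proof -
  have "continuous_map T (prod_topology T T) (\<lambda>u. (g, u))"
    using assms topspace_eq_carrier by (intro continuous_map_pairedI) auto
  from continuous_map_compose [OF this continuous_mult] show ?thesis
    by (simp add: comp_def)
qed

lemma continuous_map_right_mult:
  assumes "g \<in> carrier G" shows "continuous_map T T (\<lambda>u. u \<otimes> g)"
proof -
  have "continuous_map T (prod_topology T T) (\<lambda>u. (u, g))"
    using assms topspace_eq_carrier by (intro continuous_map_pairedI) auto
  from continuous_map_compose [OF this continuous_mult] show ?thesis
    by (simp add: comp_def)
qed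

lemma openin_carrier: "openin T U \<Longrightarrow> U \<subseteq> carrier G"
  using openin_subset topspace_eq_carrier by blast

lemma openin_preimage:
  assumes "continuous_map T T f" "openin T U" shows "openin T {g \<in> carrier G. f g \<in> U}"
  using openin_continuous_map_preimage [OF assms] by (simp add: topspace_eq_carrier)

lemma flow_closed:
  assumes "flow G T X \<alpha>" "g \<in> carrier G" "x \<in> topspace X" shows "\<alpha> g x \<in> topspace X"
proof -
  interpret group_action G "topspace X" \<alpha> using assms(1) by (simp add: flow_def)
  show ?thesis using element_image [OF assms(2,3)] by blast
qed

lemma flow_mult:
  assumes "flow G T X \<alpha>" "g \<in> carrier G" "h \<in> carrier G" "x \<in> topspace X"
  shows "\<alpha> (g \<otimes> h) x = \<alpha> g (\<alpha> h x)"
proof -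
  interpret group_action G "topspace X" \<alpha> using assms(1) by (simp add: flow_def)
  show ?thesis using composition_rule [OF assms(4,2,3)] .
qed

lemma flow_one:
  assumes "flow G T X \<alpha>" "x \<in> topspace X" shows "\<alpha> \<one> x = x"
proof -
  interpret group_action G "topspace X" \<alpha> using assms(1) by (simp add: flow_def)
  show ?thesis using id_eq_one assms(2) by (metis restrict_apply')
qed

lemma flow_continuous_translate:
  assumes "flow G T X \<alpha>" "g \<in> carrier G" shows "continuous_map X X (\<alpha> g)"
proof -
  have "continuous_map X (prod_topology T X) (\<lambda>x. (g, x))"
    using assms(2) topspace_eq_carrier by (intro continuous_map_pairedI) auto
  then have "continuous_map X X ((\<lambda>(g, x). \<alpha> g x) \<circ> (\<lambda>x. (g, x)))"
    using assms(1) by (intro continuous_map_compose) (auto simp: flow_def)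
  then show ?thesis by (simp add: comp_def)
qed

lemma flow_continuous_orbit:
  assumes "flow G T X \<alpha>" "x \<in> topspace X" shows "continuous_map T X (\<lambda>g. \<alpha> g x)"
proof -
  have "continuous_map T (prod_topology T X) (\<lambda>g. (g, x))"
    using assms(2) by (intro continuous_map_pairedI) auto
  then have "continuous_map T X ((\<lambda>(g, x). \<alpha> g x) \<circ> (\<lambda>g. (g, x)))"
    using assms(1) by (intro continuous_map_compose) (auto simp: flow_def)
  then show ?thesis by (simp add: comp_def)
qed

text \<open>
  Compactness of the space makes the group act equicontinuously near \<open>\<one>\<close>: the set of \<open>(u, x)\<close> on
  which \<open>F\<close> moves by less than \<open>\<epsilon>\<close> is an open set around \<open>{\<one>} \<times> X\<close>, so it contains a tube. This is what
  puts \<open>F\<close>, read along an orbit, into the algebra of uniformly continuous functions.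
\<close>

lemma flow_uniform:
  fixes F :: "'x \<Rightarrow> 'm::metric_space"
  assumes flow: "flow G T X \<alpha>" and F: "continuous_map X euclidean F" and "0 < \<epsilon>"
  obtains U where "openin T U" "\<one> \<in> U"
    "\<And>u x. u \<in> U \<Longrightarrow> x \<in> topspace X \<Longrightarrow> dist (F (\<alpha> u x)) (F x) < \<epsilon>"
proof -
  let ?P = "prod_topology T X"
  have a: "continuous_map ?P X (\<lambda>(g, x). \<alpha> g x)" and cpt: "compactin X (topspace X)"
    using flow by (auto simp: flow_def compact_space_def)
  have "continuous_map ?P euclidean (F \<circ> (\<lambda>(g, x). \<alpha> g x))" "continuous_map ?P euclidean (F \<circ> snd)"
    by (auto intro!: continuous_map_compose [OF _ F] a continuous_map_snd)
  then have "continuous_map ?P (prod_topology euclidean euclidean) (\<lambda>p. (F (\<alpha> (fst p) (snd p)), F (snd p)))"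
    by (intro continuous_map_pairedI) (simp_all add: comp_def case_prod_unfold)
  moreover have "openin (prod_topology euclidean euclidean) {(a, b). dist a b < \<epsilon>}"
    unfolding prod_topology_euclidean open_openin [symmetric] case_prod_unfold
    by (intro open_Collect_less continuous_intros)
  ultimately have "openin ?P {p \<in> topspace ?P. (F (\<alpha> (fst p) (snd p)), F (snd p)) \<in> {(a, b). dist a b < \<epsilon>}}"
    (is "openin _ ?Q")
    by (rule openin_continuous_map_preimage)
  moreover have "\<one> \<in> topspace T" using topspace_eq_carrier by simp
  moreover have "{\<one>} \<times> topspace X \<subseteq> ?Q"
  proof
    fix p assume "p \<in> {\<one>} \<times> topspace X"
    then obtain x where x: "p = (\<one>, x)" "x \<in> topspace X" by blast
    then show "p \<in> ?Q"
      using \<open>0 < \<epsilon>\<close> topspace_eq_carrier by (simp add: flow_one [OF flow])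
  qed
  ultimately have "\<exists>U V. openin T U \<and> openin X V \<and> \<one> \<in> U \<and> topspace X \<subseteq> V \<and> U \<times> V \<subseteq> ?Q"
    by (rule tube_lemma_right [OF _ cpt])
  then obtain U V where UV: "openin T U" "\<one> \<in> U" "topspace X \<subseteq> V" "U \<times> V \<subseteq> ?Q"
    by (elim exE conjE)
  show thesis
  proof (rule that [OF UV(1,2)])
    fix u x assume "u \<in> U" "x \<in> topspace X"
    then have "(u, x) \<in> U \<times> V" using UV(3) by blast
    then have "(u, x) \<in> ?Q" using UV(4) by (rule rev_subsetD)
    then show "dist (F (\<alpha> u x)) (F x) < \<epsilon>" by simp
  qed
qed

text \<open>
  Continuity of \<open>(g, h) \<mapsto> g\<inverse> h\<close> at \<open>(\<one>, \<one>)\<close>.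
\<close>

lemma left_quotient_neighbourhood:
  assumes "openin T U" "\<one> \<in> U"
  obtains W where "openin T W" "\<one> \<in> W" "\<And>g h. g \<in> W \<Longrightarrow> h \<in> W \<Longrightarrow> inv g \<otimes> h \<in> U"
proof -
  let ?q = "\<lambda>p. inv (fst p) \<otimes> snd p"
  have "continuous_map (prod_topology T T) (prod_topology T T) (\<lambda>p. (inv (fst p), snd p))"
    using continuous_map_compose [OF continuous_map_fst continuous_inv, of T]
    by (intro continuous_map_pairedI continuous_map_snd) (simp add: comp_def)
  from continuous_map_compose [OF this continuous_mult]
  have "continuous_map (prod_topology T T) T ?q" by (simp add: comp_def)
  then have "openin (prod_topology T T) {p \<in> topspace (prod_topology T T). ?q p \<in> U}"
    by (rule openin_continuous_map_preimage [OF _ assms(1)])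
  moreover have "(\<one>, \<one>) \<in> {p \<in> topspace (prod_topology T T). ?q p \<in> U}"
    using assms(2) topspace_eq_carrier by simp
  ultimately obtain V V' where V: "openin T V" "openin T V'" "\<one> \<in> V" "\<one> \<in> V'"
      "V \<times> V' \<subseteq> {p \<in> topspace (prod_topology T T). ?q p \<in> U}"
    unfolding openin_prod_topology_alt by meson
  show thesis
  proof (rule that [of "V \<inter> V'"])
    fix g h assume "g \<in> V \<inter> V'" "h \<in> V \<inter> V'"
    then have "(g, h) \<in> {p \<in> topspace (prod_topology T T). ?q p \<in> U}" using V(5) by blast
    then show "inv g \<otimes> h \<in> U" by simp
  qed (use V in auto)
qed

lemma flow_homeomorphic_map:
  assumes X: "flow G T X \<alpha>" and g: "g \<in> carrier G"
  shows "homeomorphic_map X X (\<alpha> g)"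
proof -
  have "homeomorphic_maps X X (\<alpha> g) (\<alpha> (inv g))"
    unfolding homeomorphic_maps_def
    using g flow_continuous_translate [OF X] flow_one [OF X]
    by (auto simp flip: flow_mult [OF X])
  then show ?thesis using homeomorphic_maps_map by blast
qed

lemma flow_interior_closure_image:
  assumes X: "flow G T X \<alpha>" and g: "g \<in> carrier G" and S: "S \<subseteq> topspace X"
  shows "X interior_of (X closure_of (\<alpha> g ` S)) = \<alpha> g ` (X interior_of (X closure_of S))"
  using homeomorphic_map_closure_of [OF flow_homeomorphic_map [OF X g] S]
    homeomorphic_map_interior_of [OF flow_homeomorphic_map [OF X g] closure_of_subset_topspace]
  by simp

lemma topological_subgroup:
  assumes H: "subgroup H G"
  shows "topological_group (G\<lparr>carrier := H\<rparr>) (subtopology T H)"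
proof -
  have HG: "H \<subseteq> carrier G" using subgroup.subset [OF H] .
  interpret H: group "G\<lparr>carrier := H\<rparr>" by (rule subgroup.subgroup_is_group [OF H is_group])
  have top: "topspace (subtopology T H) = H" using HG topspace_eq_carrier by auto
  have "continuous_map (prod_topology (subtopology T H) (subtopology T H)) T (\<lambda>(g, h). g \<otimes> h)"
    using continuous_mult
    by (simp add: prod_topology_subtopology continuous_map_from_subtopology subtopology_subtopology)
  then have "continuous_map (prod_topology (subtopology T H) (subtopology T H)) (subtopology T H)
      (\<lambda>(g, h). g \<otimes> h)"
    using subgroup.m_closed [OF H] HG topspace_eq_carrier
    by (auto simp: continuous_map_in_subtopology)
  moreover have "continuous_map (subtopology T H) (subtopology T H) (\<lambda>g. inv g)"
    using continuous_inv subgroup.m_inv_closed [OF H]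
    by (auto simp: continuous_map_in_subtopology continuous_map_from_subtopology)
  then have "continuous_map (subtopology T H) (subtopology T H) (\<lambda>g. inv\<^bsub>G\<lparr>carrier := H\<rparr>\<^esub> g)"
    by (rule continuous_map_eq) (simp add: top m_inv_consistent [OF H])
  ultimately show ?thesis
    using top by unfold_locales simp_all
qed

lemma restricted_flow:
  assumes N: "flow G T N \<nu>" and L: "subgroup L G"
    and C: "closedin N C" "C \<noteq> {}" "\<And>h z. h \<in> L \<Longrightarrow> z \<in> C \<Longrightarrow> \<nu> h z \<in> C"
  shows "flow (G\<lparr>carrier := L\<rparr>) (subtopology T L) (subtopology N C) (\<lambda>g. restrict (\<nu> g) C)"
  unfolding flow_def
proof (intro conjI)
  have LG: "L \<subseteq> carrier G" using subgroup.subset [OF L] .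
  have CN: "C \<subseteq> topspace N" using closedin_subset [OF C(1)] .
  have top: "topspace (subtopology N C) = C" using CN by auto
  interpret L: group "G\<lparr>carrier := L\<rparr>" by (rule subgroup.subgroup_is_group [OF L is_group])
  show "topspace (subtopology N C) \<noteq> {}" using C(2) top by simp
  show "compact_space (subtopology N C)"
    using N C(1) by (auto simp: flow_def intro!: compact_space_subtopology closedin_compact_space)
  show "Hausdorff_space (subtopology N C)"
    using N by (simp add: flow_def Hausdorff_space_subtopology)
  show "group_action (G\<lparr>carrier := L\<rparr>) (topspace (subtopology N C)) (\<lambda>g. restrict (\<nu> g) C)"
    unfolding top
  proof (rule L.group_actionI)
    show "restrict (\<nu> \<one>\<^bsub>G\<lparr>carrier := L\<rparr>\<^esub>) C z = z" if "z \<in> C" for z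
      using that CN flow_one [OF N] by auto
    show "restrict (\<nu> (g \<otimes>\<^bsub>G\<lparr>carrier := L\<rparr>\<^esub> h)) C z = restrict (\<nu> g) C (restrict (\<nu> h) C z)"
      if "g \<in> carrier (G\<lparr>carrier := L\<rparr>)" "h \<in> carrier (G\<lparr>carrier := L\<rparr>)" "z \<in> C" for g h z
      using that C(3) flow_mult [OF N, of g h z] CN LG by (simp add: subset_iff)
  qed (use C(3) in auto)
  have "continuous_map (prod_topology T N) N (\<lambda>(g, x). \<nu> g x)" using N by (simp add: flow_def)
  then have "continuous_map (prod_topology (subtopology T L) (subtopology N C)) N (\<lambda>(g, x). \<nu> g x)"
    by (simp add: prod_topology_subtopology continuous_map_from_subtopology)
  then have "continuous_map (prod_topology (subtopology T L) (subtopology N C)) N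
      (\<lambda>(g, x). restrict (\<nu> g) C x)"
    by (rule continuous_map_eq) auto
  then show "continuous_map (prod_topology (subtopology T L) (subtopology N C)) (subtopology N C)
      (\<lambda>(g, x). restrict (\<nu> g) C x)"
    using C(3) by (auto simp: continuous_map_in_subtopology)
qed

text \<open>
  Extreme amenability speaks of flows of the subgroup; a closed set that is invariant only under
  this subgroup is such a flow.
\<close>

lemma extremely_amenable_fixed_point:
  assumes N: "flow G T N \<nu>" and L: "subgroup L G"
    and ea: "extremely_amenable (G\<lparr>carrier := L\<rparr>) (subtopology T L)"
    and C: "closedin N C" "C \<noteq> {}" "\<And>h z. h \<in> L \<Longrightarrow> z \<in> C \<Longrightarrow> \<nu> h z \<in> C"
  obtains p where "p \<in> C" "\<And>h. h \<in> L \<Longrightarrow> \<nu> h p = p"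
proof -
  have "topspace (subtopology T L) = carrier (G\<lparr>carrier := L\<rparr>)"
    using subgroup.subset [OF L] topspace_eq_carrier by auto
  from extremely_amenableD [OF ea this restricted_flow [OF N L C]]
  obtain p where "p \<in> topspace (subtopology N C)" "\<forall>h\<in>L. restrict (\<nu> h) C p = p"
    by auto
  then show thesis by (intro that [of p]) auto
qed

end

lemma image_subflow:
  assumes Z: "flow G T Z \<gamma>" and Y: "flow G T Y \<beta>" and f: "equivariant_map G Z \<gamma> Y \<beta> f"
  shows "subflow G Y \<beta> (f ` topspace Z)"
  unfolding subflow_def
proof (intro conjI ballI)
  have cont: "continuous_map Z Y f" using f by (simp add: equivariant_map_def)
  show "f ` topspace Z \<noteq> {}" using Z by (simp add: flow_def)
  show "closedin Y (f ` topspace Z)"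
    using continuous_imp_closed_map [OF cont] Z Y by (auto simp: flow_def closed_map_def)
  interpret group_action G "topspace Z" \<gamma> using Z by (simp add: flow_def)
  fix g y assume g: "g \<in> carrier G" and "y \<in> f ` topspace Z"
  then obtain z where z: "z \<in> topspace Z" "y = f z" by blast
  then have "\<beta> g y = f (\<gamma> g z)" using f g by (simp add: equivariant_map_def)
  moreover have "\<gamma> g z \<in> topspace Z" using element_image [OF g z(1)] by blast
  ultimately show "\<beta> g y \<in> f ` topspace Z" by blast
qed

text \<open>
  The image is a subflow which still covers \<open>X\<close>.
\<close>

lemma equivariant_map_into_irreducible_surj:
  assumes Z: "flow G T Z \<gamma>" and Y: "flow G T Y \<beta>" and f: "equivariant_map G Z \<gamma> Y \<beta> f"
    and \<phi>: "irreducible_extension G Y \<beta> X \<alpha> \<phi>" and onto: "\<phi> ` f ` topspace Z = topspace X"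
  shows "f ` topspace Z = topspace Y"
  using \<phi> onto image_subflow [OF Z Y f] unfolding irreducible_extension_def by metis

section \<open>Uniformly continuous functions on a coset space\<close>

locale coset_space = topological_group G T + K: subgroup K G
  for G (structure) and T and K
begin

abbreviation cosets where "cosets \<equiv> lcosets\<^bsub>G\<^esub> K"
abbreviation alg where "alg \<equiv> samuel_algebra G T K"
abbreviation points where "points \<equiv> samuel_points G T K"
abbreviation Sa where "Sa \<equiv> samuel G T K"
abbreviation act where "act \<equiv> samuel_act G T K"

lemma coset_subset: "c \<in> cosets \<Longrightarrow> c \<subseteq> carrier G"
  using K.lcosets_carrier is_group by blast

lemma cosetE:
  assumes "c \<in> cosets" obtains g where "g \<in> carrier G" "c = g <# K"
  using assms by (auto simp: LCOSETS_def)

lemma cosetI: "g \<in> carrier G \<Longrightarrow> g <# K \<in> cosets"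
  by (auto simp: LCOSETS_def)

lemma translate_mult:
  "g \<in> carrier G \<Longrightarrow> h \<in> carrier G \<Longrightarrow> c \<in> cosets \<Longrightarrow> g <# (h <# c) = (g \<otimes> h) <# c"
  by (simp add: lcos_m_assoc coset_subset)

lemma translate_one: "c \<in> cosets \<Longrightarrow> \<one> <# c = c"
  by (simp add: lcos_mult_one coset_subset)

lemma translate_coset: "g \<in> carrier G \<Longrightarrow> c \<in> cosets \<Longrightarrow> g <# c \<in> cosets"
  by (elim cosetE) (simp add: lcos_m_assoc K.subset cosetI)

lemma alg_extensional: "f \<in> alg \<Longrightarrow> f \<in> extensional cosets"
  by (simp add: samuel_algebra_def)

lemma alg_bounded:
  assumes "f \<in> alg" obtains B where "\<And>c. c \<in> cosets \<Longrightarrow> cmod (f c) \<le> B"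
  using assms by (auto simp: samuel_algebra_def bounded_iff)

lemma alg_uniform:
  assumes "f \<in> alg" "0 < \<epsilon>"
  obtains U where "openin T U" "\<one> \<in> U" "U \<subseteq> carrier G"
    "\<And>u c. u \<in> U \<Longrightarrow> c \<in> cosets \<Longrightarrow> cmod (f (u <# c) - f c) < \<epsilon>"
proof -
  have "\<exists>U. openin T U \<and> \<one> \<in> U \<and> (\<forall>u\<in>U. \<forall>c\<in>cosets. cmod (f (u <# c) - f c) < \<epsilon>)"
    using assms unfolding samuel_algebra_def mem_Collect_eq by simp
  then obtain U where U: "openin T U" "\<one> \<in> U"
      "\<forall>u\<in>U. \<forall>c\<in>cosets. cmod (f (u <# c) - f c) < \<epsilon>"
    by (elim exE conjE)
  show thesis
    by (rule that [OF U(1,2) openin_carrier [OF U(1)]]) (use U(3) in auto)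
qed

lemma algI:
  assumes bd: "\<And>c. c \<in> cosets \<Longrightarrow> cmod (f c) \<le> B"
    and unif: "\<And>\<epsilon>. 0 < \<epsilon> \<Longrightarrow> \<exists>U. openin T U \<and> \<one> \<in> U \<and>
      (\<forall>u\<in>U. \<forall>c\<in>cosets. cmod (f (u <# c) - f c) < \<epsilon>)"
  shows "restrict f cosets \<in> alg"
  unfolding samuel_algebra_def
proof (intro CollectI conjI allI impI)
  show "bounded (restrict f cosets ` cosets)"
    using bd by (auto simp: bounded_iff)
next
  fix \<epsilon> :: real assume "\<epsilon> > 0"
  then obtain U where U: "openin T U" "\<one> \<in> U"
      "\<forall>u\<in>U. \<forall>c\<in>cosets. cmod (f (u <# c) - f c) < \<epsilon>"
    using unif by blast
  moreover have "u <# c \<in> cosets" if "u \<in> U" "c \<in> cosets" for u c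
    using that U(1) openin_carrier translate_coset by blast
  ultimately show "\<exists>U. openin T U \<and> \<one> \<in> U \<and>
      (\<forall>u\<in>U. \<forall>c\<in>cosets. cmod (restrict f cosets (u <# c) - restrict f cosets c) < \<epsilon>)"
    by (intro exI [of _ U]) auto
qed auto

text \<open>
  A continuous function on a compact set is uniformly continuous, so it preserves the defining
  condition of the algebra. Closure under the algebraic operations, under conjugation and under
  inverses bounded away from zero is obtained by choosing \<open>\<Phi>\<close> and \<open>D\<close>.
\<close>

lemma alg_compose:
  fixes \<Phi> :: "complex \<times> complex \<Rightarrow> complex"
  assumes f: "f \<in> alg" and f': "f' \<in> alg" and D: "compact D" "continuous_on D \<Phi>"
    and range: "\<And>c. c \<in> cosets \<Longrightarrow> (f c, f' c) \<in> D"
  shows "(\<lambda>c\<in>cosets. \<Phi> (f c, f' c)) \<in> alg"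
proof -
  have "bounded (\<Phi> ` D)"
    using compact_continuous_image [OF D(2,1)] by (rule compact_imp_bounded)
  then obtain B where B: "\<And>z. z \<in> D \<Longrightarrow> cmod (\<Phi> z) \<le> B"
    by (auto simp: bounded_iff)
  show ?thesis
  proof (rule algI [where B = B])
    show "cmod (\<Phi> (f c, f' c)) \<le> B" if "c \<in> cosets" for c
      using B range that by blast
    fix \<epsilon> :: real assume "0 < \<epsilon>"
    then obtain d where d: "0 < d"
        "\<And>z w. z \<in> D \<Longrightarrow> w \<in> D \<Longrightarrow> dist w z < d \<Longrightarrow> dist (\<Phi> w) (\<Phi> z) < \<epsilon>"
      using compact_uniformly_continuous [OF D(2,1)] unfolding uniformly_continuous_on_def by metis
    obtain U where U: "openin T U" "\<one> \<in> U" "U \<subseteq> carrier G"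
        "\<And>u c. u \<in> U \<Longrightarrow> c \<in> cosets \<Longrightarrow> cmod (f (u <# c) - f c) < d/2"
      using alg_uniform [OF f] d(1) half_gt_zero by metis
    obtain V where V: "openin T V" "\<one> \<in> V"
        "\<And>u c. u \<in> V \<Longrightarrow> c \<in> cosets \<Longrightarrow> cmod (f' (u <# c) - f' c) < d/2"
      using alg_uniform [OF f'] d(1) half_gt_zero by metis
    have "cmod (\<Phi> (f (u <# c), f' (u <# c)) - \<Phi> (f c, f' c)) < \<epsilon>"
      if u: "u \<in> U \<inter> V" and c: "c \<in> cosets" for u c
    proof -
      have "u <# c \<in> cosets" using u c U(3) translate_coset by blast
      moreover have "dist (f (u <# c), f' (u <# c)) (f c, f' c) < d"
      proof -
        have "dist (f (u <# c), f' (u <# c)) (f c, f' c)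
            \<le> dist (f (u <# c)) (f c) + dist (f' (u <# c)) (f' c)"
          by (simp add: dist_Pair_Pair sqrt_sum_squares_le_sum)
        then show ?thesis
          using U(4) [of u c] V(3) [of u c] u c by (auto simp: dist_norm)
      qed
      ultimately show ?thesis
        using d(2) range c by (metis dist_norm)
    qed
    then show "\<exists>U. openin T U \<and> \<one> \<in> U \<and>
        (\<forall>u\<in>U. \<forall>c\<in>cosets. cmod (\<Phi> (f (u <# c), f' (u <# c)) - \<Phi> (f c, f' c)) < \<epsilon>)"
      using U(1,2) V(1,2) by (intro exI [of _ "U \<inter> V"]) auto
  qed
qed

lemma alg_const: "(\<lambda>c\<in>cosets. a) \<in> alg"
proof (rule algI [where B = "cmod a"])
  show "\<exists>U. openin T U \<and> \<one> \<in> U \<and> (\<forall>u\<in>U. \<forall>c\<in>cosets. cmod (a - a) < \<epsilon>)" if "0 < \<epsilon>" for \<epsilon>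
    using that topspace_eq_carrier openin_topspace [of T] by (intro exI [of _ "carrier G"]) auto
qed auto

lemma alg_compose_continuous:
  fixes \<Phi> :: "complex \<times> complex \<Rightarrow> complex"
  assumes f: "f \<in> alg" and f': "f' \<in> alg" and \<Phi>: "continuous_on UNIV \<Phi>"
  shows "(\<lambda>c\<in>cosets. \<Phi> (f c, f' c)) \<in> alg"
proof -
  obtain B where B: "\<And>c. c \<in> cosets \<Longrightarrow> cmod (f c) \<le> B"
    using alg_bounded [OF f] by blast
  obtain B' where B': "\<And>c. c \<in> cosets \<Longrightarrow> cmod (f' c) \<le> B'"
    using alg_bounded [OF f'] by blast
  show ?thesis
  proof (rule alg_compose [OF f f'])
    show "compact (cball 0 B \<times> cball (0::complex) B' :: (complex \<times> complex) set)"
      by (intro compact_Times compact_cball)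
    show "continuous_on (cball 0 B \<times> cball 0 B') \<Phi>"
      using \<Phi> continuous_on_subset by blast
  qed (use B B' in auto)
qed

lemma alg_add: "f \<in> alg \<Longrightarrow> f' \<in> alg \<Longrightarrow> (\<lambda>c\<in>cosets. f c + f' c) \<in> alg"
  using alg_compose_continuous [of f f' "\<lambda>z. fst z + snd z"]
  by (simp add: continuous_on_add continuous_on_fst continuous_on_snd)

lemma alg_mult: "f \<in> alg \<Longrightarrow> f' \<in> alg \<Longrightarrow> (\<lambda>c\<in>cosets. f c * f' c) \<in> alg"
  using alg_compose_continuous [of f f' "\<lambda>z. fst z * snd z"]
  by (simp add: continuous_on_mult continuous_on_fst continuous_on_snd)

lemma alg_diff: "f \<in> alg \<Longrightarrow> f' \<in> alg \<Longrightarrow> (\<lambda>c\<in>cosets. f c - f' c) \<in> alg"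
  using alg_compose_continuous [of f f' "\<lambda>z. fst z - snd z"]
  by (simp add: continuous_on_diff continuous_on_fst continuous_on_snd)

lemma alg_scale: "f \<in> alg \<Longrightarrow> (\<lambda>c\<in>cosets. a * f c) \<in> alg"
  using alg_compose_continuous [of f f "\<lambda>z. a * fst z"]
  by (simp add: continuous_on_mult continuous_on_fst)

lemma alg_diff_const: "f \<in> alg \<Longrightarrow> (\<lambda>c\<in>cosets. f c - a) \<in> alg"
  using alg_compose_continuous [of f f "\<lambda>z. fst z - a"]
  by (simp add: continuous_on_diff continuous_on_fst)

lemma alg_cnj: "f \<in> alg \<Longrightarrow> (\<lambda>c\<in>cosets. cnj (f c)) \<in> alg"
  using alg_compose_continuous [of f f "\<lambda>z. cnj (fst z)"]
  by (simp add: continuous_on_cnj continuous_on_fst)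

lemma alg_inverse:
  assumes f: "f \<in> alg" and "0 < \<delta>" and \<delta>: "\<And>c. c \<in> cosets \<Longrightarrow> \<delta> \<le> cmod (f c)"
  shows "(\<lambda>c\<in>cosets. inverse (f c)) \<in> alg"
proof -
  obtain B where B: "\<And>c. c \<in> cosets \<Longrightarrow> cmod (f c) \<le> B"
    using alg_bounded [OF f] by blast
  define A where "A = cball 0 B - ball (0::complex) \<delta>"
  have A: "compact A" "0 \<notin> A"
    using \<open>0 < \<delta>\<close> by (auto simp: A_def intro!: compact_diff)
  have "(\<lambda>c\<in>cosets. (\<lambda>z. inverse (fst z)) (f c, f c)) \<in> alg"
  proof (rule alg_compose [OF f f, where D = "A \<times> A"])
    show "compact (A \<times> A)" by (intro compact_Times A)
    show "continuous_on (A \<times> A) (\<lambda>z. inverse (fst z))"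
      using A by (intro continuous_intros) auto
    show "(f c, f c) \<in> A \<times> A" if "c \<in> cosets" for c
      using B [OF that] \<delta> [OF that] by (simp add: A_def)
  qed
  then show ?thesis by simp
qed

text \<open>
  Translating by \<open>g\<close> from the left turns a small \<open>u\<close> into its conjugate by \<open>g\<close>, which is still small.
\<close>

lemma alg_translate:
  assumes f: "f \<in> alg" and g: "g \<in> carrier G"
  shows "(\<lambda>c\<in>cosets. f (g <# c)) \<in> alg"
proof -
  obtain B where B: "\<And>c. c \<in> cosets \<Longrightarrow> cmod (f c) \<le> B"
    using alg_bounded [OF f] by blast
  show ?thesis
  proof (rule algI [where B = B])
    show "cmod (f (g <# c)) \<le> B" if "c \<in> cosets" for c
      using B g translate_coset that by blast
    fix \<epsilon> :: real assume "0 < \<epsilon>"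
    then obtain U where U: "openin T U" "\<one> \<in> U"
        "\<And>u c. u \<in> U \<Longrightarrow> c \<in> cosets \<Longrightarrow> cmod (f (u <# c) - f c) < \<epsilon>"
      using alg_uniform [OF f] by metis
    define V where "V = {u \<in> carrier G. g \<otimes> u \<otimes> inv g \<in> U}"
    have "continuous_map T T ((\<lambda>u. u \<otimes> inv g) \<circ> (\<lambda>u. g \<otimes> u))"
      using g by (intro continuous_map_compose [OF continuous_map_left_mult continuous_map_right_mult]) auto
    then have "openin T V"
      unfolding V_def using openin_preimage [OF _ U(1)] by (simp add: comp_def)
    moreover have "\<one> \<in> V" using g U(2) by (simp add: V_def)
    moreover have "cmod (f (g <# (u <# c)) - f (g <# c)) < \<epsilon>" if "u \<in> V" and c: "c \<in> cosets" for u c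
    proof -
      have u: "u \<in> carrier G" "g \<otimes> u \<otimes> inv g \<in> U" using that by (auto simp: V_def)
      have "(g \<otimes> u \<otimes> inv g) <# (g <# c) = g <# (u <# c)"
        using g u c by (simp add: translate_mult translate_coset m_assoc)
      then show ?thesis using U(3) [OF u(2) translate_coset [OF g c]] by simp
    qed
    ultimately show "\<exists>U. openin T U \<and> \<one> \<in> U \<and>
        (\<forall>u\<in>U. \<forall>c\<in>cosets. cmod (f (g <# (u <# c)) - f (g <# c)) < \<epsilon>)"
      by blast
  qed
qed

section \<open>Characters\<close>

lemma character_add: "\<xi> \<in> points \<Longrightarrow> f \<in> alg \<Longrightarrow> f' \<in> alg \<Longrightarrow> \<xi> (\<lambda>c\<in>cosets. f c + f' c) = \<xi> f + \<xi> f'"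
  and character_mult: "\<xi> \<in> points \<Longrightarrow> f \<in> alg \<Longrightarrow> f' \<in> alg \<Longrightarrow> \<xi> (\<lambda>c\<in>cosets. f c * f' c) = \<xi> f * \<xi> f'"
  and character_scale: "\<xi> \<in> points \<Longrightarrow> f \<in> alg \<Longrightarrow> \<xi> (\<lambda>c\<in>cosets. a * f c) = a * \<xi> f"
  unfolding samuel_points_def by blast+

lemma character_const:
  assumes "\<xi> \<in> points" shows "\<xi> (\<lambda>c\<in>cosets. a) = a"
proof -
  obtain f where f: "f \<in> alg" "\<xi> f \<noteq> 0" using assms unfolding samuel_points_def by blast
  have "(\<lambda>c\<in>cosets. (\<lambda>c\<in>cosets. 1) c * f c) = f"
    using alg_extensional [OF f(1)] by (intro ext) (auto simp: extensional_def)
  then have "\<xi> (\<lambda>c\<in>cosets. 1) = 1"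
    using character_mult [OF assms alg_const f(1), of 1] f(2) by simp
  moreover have "(\<lambda>c\<in>cosets. a) = (\<lambda>c\<in>cosets. a * (\<lambda>c\<in>cosets. 1) c)" by auto
  ultimately show ?thesis
    using character_scale [OF assms alg_const, of a 1] by simp
qed

lemma character_diff_const:
  assumes "\<xi> \<in> points" "f \<in> alg" shows "\<xi> (\<lambda>c\<in>cosets. f c - a) = \<xi> f - a"
proof -
  have "(\<lambda>c\<in>cosets. f c - a) = (\<lambda>c\<in>cosets. f c + (\<lambda>c\<in>cosets. - a) c)" by auto
  then show ?thesis
    by (simp only: character_add [OF assms alg_const] character_const [OF assms(1)]
        diff_conv_add_uminus)
qed

text \<open>
  A function bounded away from zero is invertible in the algebra.
\<close>

lemma character_nonzero:
  assumes \<xi>: "\<xi> \<in> points" and f: "f \<in> alg" and \<delta>: "0 < \<delta>" "\<And>c. c \<in> cosets \<Longrightarrow> \<delta> \<le> cmod (f c)"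
  shows "\<xi> f \<noteq> 0"
proof
  assume "\<xi> f = 0"
  then have "\<xi> (\<lambda>c\<in>cosets. f c * (\<lambda>c\<in>cosets. inverse (f c)) c) = 0"
    using character_mult [OF \<xi> f alg_inverse [OF f \<delta>]] by simp
  moreover have "(\<lambda>c\<in>cosets. f c * (\<lambda>c\<in>cosets. inverse (f c)) c) = (\<lambda>c\<in>cosets. 1)"
  proof (rule restrict_ext)
    fix c assume c: "c \<in> cosets"
    have "f c \<noteq> 0" using \<delta>(1) \<delta>(2) [OF c] by auto
    then show "f c * (\<lambda>c\<in>cosets. inverse (f c)) c = 1" using c by simp
  qed
  ultimately show False using character_const [OF \<xi>, of 1] by simp
qed

text \<open>
  Otherwise the function \<open>\<Sum>f\<in>F. (f - \<xi> f) * cnj (f - \<xi> f)\<close> is at least \<open>\<delta>\<^sup>2\<close> everywhere, so \<open>\<xi>\<close> does not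
  vanish on it; but \<open>\<xi>\<close> vanishes on each factor \<open>f - \<xi> f\<close>. This one argument gives both the
  continuity of characters and the density of the cosets.
\<close>

lemma character_approximation:
  assumes \<xi>: "\<xi> \<in> points" and F: "finite F" "F \<subseteq> alg" and "0 < \<delta>"
  obtains c where "c \<in> cosets" "\<And>f. f \<in> F \<Longrightarrow> cmod (f c - \<xi> f) < \<delta>"
proof (rule ccontr)
  assume "\<not> thesis"
  then have far: "\<exists>f\<in>F. \<delta> \<le> cmod (f c - \<xi> f)" if "c \<in> cosets" for c
    using that \<open>\<And>c. \<lbrakk>c \<in> cosets; \<And>f. f \<in> F \<Longrightarrow> cmod (f c - \<xi> f) < \<delta>\<rbrakk> \<Longrightarrow> thesis\<close> by (meson not_le)
  define q where "q E = (\<lambda>c\<in>cosets. complex_of_real (\<Sum>f\<in>E. (cmod (f c - \<xi> f))\<^sup>2))" for E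
  have "q E \<in> alg \<and> \<xi> (q E) = 0" if "finite E" "E \<subseteq> alg" for E
    using that
  proof (induction E)
    case empty
    have "q {} = (\<lambda>c\<in>cosets. 0)" by (auto simp: q_def)
    then show ?case using alg_const [of 0] character_const [OF \<xi>, of 0] by (simp only: simp_thms)
  next
    case (insert f E)
    have f: "f \<in> alg" using insert.prems by simp
    define a where "a = (\<lambda>c\<in>cosets. f c - \<xi> f)"
    define b where "b = (\<lambda>c\<in>cosets. cnj (a c))"
    have a: "a \<in> alg" "\<xi> a = 0"
      unfolding a_def using alg_diff_const [OF f] character_diff_const [OF \<xi> f] by auto
    have b: "b \<in> alg"
      unfolding b_def by (rule alg_cnj [OF a(1)])
    have "q (insert f E) = (\<lambda>c\<in>cosets. (\<lambda>c\<in>cosets. a c * b c) c + q E c)"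
      unfolding q_def
    proof (rule restrict_ext)
      fix c assume c: "c \<in> cosets"
      have "complex_of_real ((cmod (f c - \<xi> f))\<^sup>2) = a c * b c"
        using c by (simp only: a_def b_def restrict_apply' complex_norm_square)
      then show "complex_of_real (\<Sum>f\<in>insert f E. (cmod (f c - \<xi> f))\<^sup>2) =
          (\<lambda>c\<in>cosets. a c * b c) c +
          (\<lambda>c\<in>cosets. complex_of_real (\<Sum>f\<in>E. (cmod (f c - \<xi> f))\<^sup>2)) c"
        using c by (simp only: sum.insert [OF insert.hyps] of_real_add restrict_apply')
    qed
    moreover have E: "q E \<in> alg" "\<xi> (q E) = 0" using insert by auto
    moreover have "\<xi> (\<lambda>c\<in>cosets. a c * b c) = 0"
      by (simp only: character_mult [OF \<xi> a(1) b] a(2) mult_zero_left)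
    ultimately show ?case
      using alg_add [OF alg_mult [OF a(1) b] E(1)] character_add [OF \<xi> alg_mult [OF a(1) b] E(1)]
      by (simp only: add_0_left simp_thms)
  qed
  then have "q F \<in> alg" "\<xi> (q F) = 0" using F by auto
  moreover have "\<delta>\<^sup>2 \<le> cmod (q F c)" if c: "c \<in> cosets" for c
  proof -
    obtain f where f: "f \<in> F" "\<delta> \<le> cmod (f c - \<xi> f)" using far c by blast
    have "\<delta>\<^sup>2 \<le> (cmod (f c - \<xi> f))\<^sup>2"
      using f(2) \<open>0 < \<delta>\<close> by (simp add: power_mono)
    also have "\<dots> \<le> (\<Sum>f\<in>F. (cmod (f c - \<xi> f))\<^sup>2)"
      using F(1) f(1) by (intro member_le_sum) auto
    also have "\<dots> \<le> cmod (q F c)"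
      using c by (simp add: q_def del: of_real_sum)
    finally show ?thesis .
  qed
  ultimately show False
    using character_nonzero [OF \<xi>, of "q F" "\<delta>\<^sup>2"] \<open>0 < \<delta>\<close> by simp
qed

lemma character_bound:
  assumes \<xi>: "\<xi> \<in> points" and f: "f \<in> alg" and B: "\<And>c. c \<in> cosets \<Longrightarrow> cmod (f c) \<le> B"
  shows "cmod (\<xi> f) \<le> B"
proof (rule field_le_epsilon)
  fix \<epsilon> :: real assume "0 < \<epsilon>"
  then obtain c where "c \<in> cosets" "cmod (f c - \<xi> f) < \<epsilon>"
    using character_approximation [OF \<xi>, of "{f}" \<epsilon>] f by auto
  then show "cmod (\<xi> f) \<le> B + \<epsilon>"
    using B [of c] norm_triangle_ineq4 [of "f c" "f c - \<xi> f"] by simp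
qed

lemma character_diff:
  assumes \<xi>: "\<xi> \<in> points" and f: "f \<in> alg" and f': "f' \<in> alg"
  shows "\<xi> (\<lambda>c\<in>cosets. f c - f' c) = \<xi> f - \<xi> f'"
proof -
  have "(\<lambda>c\<in>cosets. f c - f' c) = (\<lambda>c\<in>cosets. f c + (\<lambda>c\<in>cosets. -1 * f' c) c)" by auto
  then show ?thesis
    by (simp only: character_add [OF \<xi> f alg_scale [OF f']] character_scale [OF \<xi> f'])
      simp
qed

section \<open>The space of characters\<close>

lemma topspace_samuel [simp]: "topspace Sa = points"
  by (auto simp: samuel_def samuel_points_def PiE_def)

lemma character_extensional: "\<xi> \<in> points \<Longrightarrow> \<xi> \<in> extensional alg"
  by (simp add: samuel_points_def)

lemma character_eqI:
  assumes "\<xi> \<in> points" "\<eta> \<in> points" "\<And>f. f \<in> alg \<Longrightarrow> \<xi> f = \<eta> f" shows "\<xi> = \<eta>"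
  using assms by (intro extensionalityI [of \<xi> alg \<eta>]) (auto simp: character_extensional)

lemma continuous_map_coordinate:
  assumes "f \<in> alg" shows "continuous_map Sa euclidean (\<lambda>\<xi>. \<xi> f)"
  unfolding samuel_def
  by (rule continuous_map_from_subtopology [OF continuous_map_product_projection [OF assms]])

lemma continuous_map_into_samuel:
  assumes "\<And>x. x \<in> topspace X \<Longrightarrow> h x \<in> points"
    and "\<And>f. f \<in> alg \<Longrightarrow> continuous_map X euclidean (\<lambda>x. h x f)"
  shows "continuous_map X Sa h"
proof -
  have "h ` topspace X \<subseteq> extensional alg"
    using assms(1) by (auto simp: samuel_points_def)
  then have "continuous_map X (product_topology (\<lambda>_. euclidean) alg) h"
    using assms(2) by (simp add: continuous_map_componentwise)
  then show ?thesis
    using assms(1) by (auto simp: samuel_def continuous_map_in_subtopology)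
qed

lemma Hausdorff_samuel: "Hausdorff_space Sa"
  unfolding samuel_def by (intro Hausdorff_space_subtopology)
    (simp add: Hausdorff_space_product_topology)

text \<open>
  The topology of pointwise convergence has basic neighbourhoods given by finitely many functions
  and one common tolerance.
\<close>

lemma samuel_neighbourhood:
  assumes "openin Sa W" "\<xi> \<in> W"
  obtains F \<delta> where "finite F" "F \<subseteq> alg" "0 < \<delta>"
    "\<And>\<eta>. \<eta> \<in> points \<Longrightarrow> (\<And>f. f \<in> F \<Longrightarrow> cmod (\<eta> f - \<xi> f) < \<delta>) \<Longrightarrow> \<eta> \<in> W"
proof -
  obtain V where V: "openin (product_topology (\<lambda>_. euclidean) alg) V" "W = V \<inter> points"
    using assms(1) by (auto simp: samuel_def openin_subtopology)
  then obtain U where U: "finite {f \<in> alg. U f \<noteq> UNIV}" "\<And>f. f \<in> alg \<Longrightarrow> open (U f)"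
      "\<xi> \<in> Pi\<^sub>E alg U" "Pi\<^sub>E alg U \<subseteq> V"
    using assms(2) unfolding openin_product_topology_alt by (auto simp: Ball_def)
  define F where "F = {f \<in> alg. U f \<noteq> UNIV}"
  have "\<exists>\<delta>>0. ball (\<xi> f) \<delta> \<subseteq> U f" if "f \<in> F" for f
    using that U(2,3) open_contains_ball by (fastforce simp: F_def PiE_iff)
  then obtain d where d: "\<And>f. f \<in> F \<Longrightarrow> 0 < d f \<and> ball (\<xi> f) (d f) \<subseteq> U f" by metis
  define \<delta> where "\<delta> = Min (insert 1 (d ` F))"
  have F: "finite F" using U(1) by (simp add: F_def)
  have "0 < \<delta>" using d F by (simp add: \<delta>_def)
  moreover have "\<eta> \<in> W" if \<eta>: "\<eta> \<in> points" "\<And>f. f \<in> F \<Longrightarrow> cmod (\<eta> f - \<xi> f) < \<delta>" for \<eta>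
  proof -
    have "\<eta> f \<in> U f" if "f \<in> alg" for f
    proof (cases "f \<in> F")
      case True
      then have "\<delta> \<le> d f" using F by (simp add: \<delta>_def)
      then have "\<eta> f \<in> ball (\<xi> f) (d f)"
        using \<eta>(2) [OF True] by (simp add: dist_norm norm_minus_commute)
      then show ?thesis using d True by blast
    qed (use that in \<open>auto simp: F_def\<close>)
    then have "\<eta> \<in> Pi\<^sub>E alg U" using \<eta>(1) by (auto simp: samuel_points_def PiE_def)
    then show ?thesis using U(4) V(2) \<eta>(1) by blast
  qed
  ultimately show thesis
    using F by (intro that [of F \<delta>]) (auto simp: F_def)
qed

definition ev where "ev c = (\<lambda>f\<in>alg. f c)"

lemma ev_apply: "f \<in> alg \<Longrightarrow> ev c f = f c"
  by (simp add: ev_def)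

lemma ev_in_points:
  assumes "c \<in> cosets" shows "ev c \<in> points"
  unfolding samuel_points_def
proof (intro CollectI conjI ballI allI)
  show "\<exists>f\<in>alg. ev c f \<noteq> 0"
    using assms alg_const [of 1] by (intro bexI [of _ "\<lambda>c\<in>cosets. 1"]) (auto simp: ev_apply)
  fix f f' assume f: "f \<in> alg" "f' \<in> alg"
  show "ev c (\<lambda>c\<in>cosets. f c + f' c) = ev c f + ev c f'"
    using assms f by (simp add: ev_apply alg_add)
  show "ev c (\<lambda>c\<in>cosets. f c * f' c) = ev c f * ev c f'"
    using assms f by (simp add: ev_apply alg_mult)
next
  fix a f assume f: "f \<in> alg"
  show "ev c (\<lambda>c\<in>cosets. a * f c) = a * ev c f"
    using assms f by (simp add: ev_apply alg_scale)
qed (simp add: ev_def)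

text \<open>
  Density of \<open>G/K\<close>, in the form in which it is used: a closed set of characters that contains all
  evaluations is everything.
\<close>

lemma ev_dense:
  assumes "closedin Sa E" "ev ` cosets \<subseteq> E" shows "E = points"
proof (rule ccontr)
  assume "E \<noteq> points"
  then obtain \<xi> where \<xi>: "\<xi> \<in> points" "\<xi> \<in> points - E"
    using closedin_subset [OF assms(1)] by auto
  have "openin Sa (points - E)" using assms(1) by (simp add: closedin_def)
  then obtain F \<delta> where F: "finite F" "F \<subseteq> alg" "0 < \<delta>"
    "\<And>\<eta>. \<eta> \<in> points \<Longrightarrow> (\<And>f. f \<in> F \<Longrightarrow> cmod (\<eta> f - \<xi> f) < \<delta>) \<Longrightarrow> \<eta> \<in> points - E"
    using samuel_neighbourhood [OF _ \<xi>(2)] by metis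
  obtain c where c: "c \<in> cosets" "\<And>f. f \<in> F \<Longrightarrow> cmod (f c - \<xi> f) < \<delta>"
    using character_approximation [OF \<xi>(1) F(1,2,3)] by blast
  have "cmod (ev c f - \<xi> f) < \<delta>" if "f \<in> F" for f
    using c(2) [OF that] F(2) that by (simp add: ev_apply subset_iff)
  then have "ev c \<in> points - E" using F(4) ev_in_points [OF c(1)] by blast
  then show False using assms(2) c(1) by auto
qed

text \<open>
  Characters form a closed subset of a product of discs, because \<open>character_bound\<close> confines their
  values. Being nonzero becomes a closed condition when it is expressed by the value at the constant
  function \<open>1\<close>.
\<close>

lemma compact_samuel: "compact_space Sa"
proof -
  define P where "P = product_topology (\<lambda>_. euclidean :: complex topology) alg"
  have coord: "continuous_map P euclidean (\<lambda>\<xi>. \<xi> f)" if "f \<in> alg" for f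
    unfolding P_def using continuous_map_product_projection [OF that] .
  have eqn: "closedin P {\<xi> \<in> topspace P. a \<xi> = b \<xi>}"
    if "continuous_map P euclidean a" "continuous_map P euclidean b"
    for a b :: "_ \<Rightarrow> complex"
    using that by (intro closedin_continuous_maps_eq [of euclidean]) auto
  define one where "one = (\<lambda>c\<in>cosets. 1 :: complex)"
  have one: "one \<in> alg" unfolding one_def by (rule alg_const)
  have mult: "continuous_map P euclidean (\<lambda>\<xi>. a \<xi> * b \<xi>)"
    if "continuous_map P euclidean a" "continuous_map P euclidean b"
    for a b :: "_ \<Rightarrow> complex"
    using that by (simp add: continuous_map_atin tendsto_mult)
  have P: "topspace P = extensional alg" by (auto simp: P_def PiE_def)
  have "points = {\<xi> \<in> topspace P. \<xi> one = 1} \<inter>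
    (\<Inter>f\<in>alg. \<Inter>f'\<in>alg. {\<xi> \<in> topspace P. \<xi> (\<lambda>c\<in>cosets. f c + f' c) = \<xi> f + \<xi> f'} \<inter>
        {\<xi> \<in> topspace P. \<xi> (\<lambda>c\<in>cosets. f c * f' c) = \<xi> f * \<xi> f'}) \<inter>
    (\<Inter>a. \<Inter>f\<in>alg. {\<xi> \<in> topspace P. \<xi> (\<lambda>c\<in>cosets. a * f c) = a * \<xi> f})" (is "_ = ?R")
  proof (intro equalityI subsetI)
    fix \<xi> assume \<xi>: "\<xi> \<in> points"
    have "\<xi> \<in> topspace P" using \<xi> by (simp add: P samuel_points_def)
    then show "\<xi> \<in> ?R"
      using character_const [OF \<xi>, of 1] character_add [OF \<xi>] character_mult [OF \<xi>]
        character_scale [OF \<xi>] by (simp add: one_def)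
  next
    fix \<xi> assume \<xi>: "\<xi> \<in> ?R"
    then have "\<exists>f\<in>alg. \<xi> f \<noteq> 0" using one by (intro bexI [of _ one]) auto
    with \<xi> show "\<xi> \<in> points"
      unfolding samuel_points_def P by simp
  qed
  also have "closedin P \<dots>"
    using one by (intro closedin_Int closedin_INT eqn coord continuous_map_add
        continuous_map_canonical_const alg_add alg_mult alg_scale mult) auto
  finally have closed: "closedin P points" .
  have "\<exists>B. \<forall>c\<in>cosets. cmod (f c) \<le> B" if "f \<in> alg" for f
    by (rule alg_bounded [OF that]) blast
  then have "\<forall>f\<in>alg. \<exists>B. \<forall>c\<in>cosets. cmod (f c) \<le> B" by blast
  then obtain b where b: "\<forall>f\<in>alg. \<forall>c\<in>cosets. cmod (f c) \<le> b f"
    unfolding bchoice_iff ..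
  have "compactin P (Pi\<^sub>E alg (\<lambda>f. cball 0 (b f)))"
    unfolding P_def by (simp add: compactin_PiE)
  moreover have "points \<subseteq> Pi\<^sub>E alg (\<lambda>f. cball 0 (b f))"
  proof
    fix \<xi> assume \<xi>: "\<xi> \<in> points"
    have "cmod (\<xi> f) \<le> b f" if "f \<in> alg" for f
      by (rule character_bound [OF \<xi> that]) (use b that in blast)
    then show "\<xi> \<in> Pi\<^sub>E alg (\<lambda>f. cball 0 (b f))"
      using character_extensional [OF \<xi>] by (simp add: PiE_iff)
  qed
  ultimately have "compactin P points"
    using closed closed_compactin by blast
  then show ?thesis
    unfolding samuel_def P_def [symmetric] by (rule compact_space_subtopology)
qed

section \<open>The action on characters\<close>

lemma act_apply:
  "\<xi> \<in> points \<Longrightarrow> f \<in> alg \<Longrightarrow> act g \<xi> f = \<xi> (\<lambda>c\<in>cosets. f (g <# c))"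
  by (simp add: samuel_act_def)

lemma act_in_points:
  assumes g: "g \<in> carrier G" and \<xi>: "\<xi> \<in> points" shows "act g \<xi> \<in> points"
  unfolding samuel_points_def
proof (intro CollectI conjI ballI allI)
  show "act g \<xi> \<in> extensional alg"
    using \<xi> by (simp add: samuel_act_def)
  have "act g \<xi> (\<lambda>c\<in>cosets. 1) = \<xi> (\<lambda>c\<in>cosets. 1)"
    unfolding act_apply [OF \<xi> alg_const]
    by (intro arg_cong [of _ _ \<xi>] restrict_ext) (simp add: g translate_coset)
  then show "\<exists>f\<in>alg. act g \<xi> f \<noteq> 0"
    using character_const [OF \<xi>, of 1] alg_const [of 1] by (metis zero_neq_one)
  fix f f' assume f: "f \<in> alg" and f': "f' \<in> alg"
  note tf = alg_translate [OF f g] and tf' = alg_translate [OF f' g]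
  show "act g \<xi> (\<lambda>c\<in>cosets. f c + f' c) = act g \<xi> f + act g \<xi> f'"
    unfolding act_apply [OF \<xi> f] act_apply [OF \<xi> f'] act_apply [OF \<xi> alg_add [OF f f']]
      character_add [OF \<xi> tf tf', symmetric]
    by (intro arg_cong [of _ _ \<xi>] restrict_ext) (simp add: g translate_coset)
  show "act g \<xi> (\<lambda>c\<in>cosets. f c * f' c) = act g \<xi> f * act g \<xi> f'"
    unfolding act_apply [OF \<xi> f] act_apply [OF \<xi> f'] act_apply [OF \<xi> alg_mult [OF f f']]
      character_mult [OF \<xi> tf tf', symmetric]
    by (intro arg_cong [of _ _ \<xi>] restrict_ext) (simp add: g translate_coset)
next
  fix a f assume f: "f \<in> alg"
  show "act g \<xi> (\<lambda>c\<in>cosets. a * f c) = a * act g \<xi> f"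
    unfolding act_apply [OF \<xi> f] act_apply [OF \<xi> alg_scale [OF f]]
      character_scale [OF \<xi> alg_translate [OF f g], symmetric]
    by (intro arg_cong [of _ _ \<xi>] restrict_ext) (simp add: g translate_coset)
qed

lemma act_mult:
  assumes g: "g \<in> carrier G" and h: "h \<in> carrier G" and \<xi>: "\<xi> \<in> points"
  shows "act (g \<otimes> h) \<xi> = act g (act h \<xi>)"
proof (rule character_eqI)
  fix f assume f: "f \<in> alg"
  show "act (g \<otimes> h) \<xi> f = act g (act h \<xi>) f"
    unfolding act_apply [OF \<xi> f] act_apply [OF act_in_points [OF h \<xi>] f]
      act_apply [OF \<xi> alg_translate [OF f g]]
    by (intro arg_cong [of _ _ \<xi>] restrict_ext) (simp add: g h translate_coset translate_mult)
qed (use assms act_in_points in auto)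

lemma act_one:
  assumes \<xi>: "\<xi> \<in> points" shows "act \<one> \<xi> = \<xi>"
proof (rule character_eqI)
  fix f assume f: "f \<in> alg"
  have "(\<lambda>c\<in>cosets. f (\<one> <# c)) = f"
    using alg_extensional [OF f] by (intro extensionalityI [of _ cosets]) (auto simp: translate_one)
  then show "act \<one> \<xi> f = \<xi> f"
    unfolding act_apply [OF \<xi> f] by simp
qed (use assms act_in_points in auto)

lemma act_ev:
  assumes g: "g \<in> carrier G" and c: "c \<in> cosets" shows "act g (ev c) = ev (g <# c)"
proof (rule character_eqI)
  fix f assume f: "f \<in> alg"
  show "act g (ev c) f = ev (g <# c) f"
    unfolding act_apply [OF ev_in_points [OF c] f] ev_apply [OF f] ev_apply [OF alg_translate [OF f g]]
    using c by simp
qed (use assms act_in_points ev_in_points translate_coset in auto)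

text \<open>
  Moving \<open>g\<close> slightly changes the translate of \<open>f\<close> by little in the supremum norm, uniformly in the
  character; moving the character changes the value at the fixed translate by little.
\<close>

lemma continuous_act: "continuous_map (prod_topology T Sa) Sa (\<lambda>(g, \<xi>). act g \<xi>)"
proof (rule continuous_map_into_samuel)
  show "(case x of (g, \<xi>) \<Rightarrow> act g \<xi>) \<in> points" if "x \<in> topspace (prod_topology T Sa)" for x
    using that act_in_points topspace_eq_carrier by auto
  fix f assume f: "f \<in> alg"
  let ?h = "\<lambda>x. (case x of (g, \<xi>) \<Rightarrow> act g \<xi>) f"
  show "continuous_map (prod_topology T Sa) euclidean ?h"
  proof (rule continuous_map_euclideanI)
    fix x and \<epsilon> :: real assume x: "x \<in> topspace (prod_topology T Sa)" and "0 < \<epsilon>"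
    obtain g \<xi> where g: "x = (g, \<xi>)" "g \<in> carrier G" and \<xi>: "\<xi> \<in> points"
      using x topspace_eq_carrier by auto
    define t where "t h = (\<lambda>c\<in>cosets. f (h <# c))" for h
    have t: "t h \<in> alg" if "h \<in> carrier G" for h
      unfolding t_def using alg_translate [OF f that] .
    obtain U where U: "openin T U" "\<one> \<in> U"
        "\<And>u c. u \<in> U \<Longrightarrow> c \<in> cosets \<Longrightarrow> cmod (f (u <# c) - f c) < \<epsilon>/2"
      using alg_uniform [OF f] \<open>0 < \<epsilon>\<close> half_gt_zero by metis
    define V where "V = {h \<in> carrier G. h \<otimes> inv g \<in> U}"
    define W where "W = {\<eta> \<in> topspace Sa. \<eta> (t g) \<in> ball (\<xi> (t g)) (\<epsilon>/2)}"
    have "openin T V"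
      unfolding V_def using g by (intro openin_preimage continuous_map_right_mult U) auto
    moreover have "openin Sa W"
      unfolding W_def
      by (rule openin_continuous_map_preimage [OF continuous_map_coordinate [OF t [OF g(2)]]]) simp
    ultimately have "openin (prod_topology T Sa) (V \<times> W)"
      by (simp add: openin_prod_Times_iff)
    moreover have "x \<in> V \<times> W"
      using g \<xi> U(2) \<open>0 < \<epsilon>\<close> by (simp add: V_def W_def)
    moreover have "dist (?h y) (?h x) < \<epsilon>" if "y \<in> V \<times> W" for y
    proof -
      obtain h \<eta> where y: "y = (h, \<eta>)" by (cases y)
      have h: "h \<in> carrier G" "h \<otimes> inv g \<in> U"
        and \<eta>: "\<eta> \<in> points" "dist (\<eta> (t g)) (\<xi> (t g)) < \<epsilon>/2"
        using that by (auto simp: y V_def W_def dist_commute)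
      have "cmod (\<eta> (\<lambda>c\<in>cosets. t h c - t g c)) \<le> \<epsilon>/2"
      proof (rule character_bound [OF \<eta>(1)])
        show "(\<lambda>c\<in>cosets. t h c - t g c) \<in> alg"
          by (rule alg_diff [OF t t]) (use g h in auto)
        fix c assume c: "c \<in> cosets"
        have "(h \<otimes> inv g) <# (g <# c) = h <# c"
          using g h c by (simp add: translate_mult m_assoc)
        then have "cmod (f (h <# c) - f (g <# c)) < \<epsilon>/2"
          using U(3) [OF h(2) translate_coset [OF g(2) c]] by simp
        then show "cmod ((\<lambda>c\<in>cosets. t h c - t g c) c) \<le> \<epsilon>/2"
          using c by (simp add: t_def)
      qed
      then have "dist (\<eta> (t h)) (\<eta> (t g)) \<le> \<epsilon>/2"
        unfolding character_diff [OF \<eta>(1) t [OF h(1)] t [OF g(2)]] dist_norm .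
      then have "dist (\<eta> (t h)) (\<xi> (t g)) < \<epsilon>"
        using \<eta>(2) dist_triangle [of "\<eta> (t h)" "\<xi> (t g)" "\<eta> (t g)"] by linarith
      then show ?thesis
        using y g act_apply [OF \<eta>(1) f] act_apply [OF \<xi> f] by (simp add: t_def)
    qed
    ultimately show "\<exists>W. openin (prod_topology T Sa) W \<and> x \<in> W \<and> (\<forall>y\<in>W. dist (?h y) (?h x) < \<epsilon>)"
      by blast
  qed
qed

definition base where "base = ev K"

lemma base_coset: "K \<in> cosets"
  using cosetI [OF one_closed] lcos_mult_one [OF K.subset] by simp

lemma base_in_points: "base \<in> points"
  unfolding base_def by (rule ev_in_points [OF base_coset])

lemma act_base: "g \<in> carrier G \<Longrightarrow> act g base = ev (g <# K)"
  unfolding base_def by (rule act_ev [OF _ base_coset])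

lemma act_base_fixed:
  assumes "h \<in> K" shows "act h base = base"
  using act_base [OF K.mem_carrier [OF assms]] coset_join3 [OF K.mem_carrier [OF assms] K.subgroup_axioms assms]
  by (simp add: base_def)

text \<open>
  The orbit of the base point consists of the evaluations at all cosets.
\<close>

lemma base_dense:
  assumes E: "closedin Sa E" "base \<in> E" "\<And>g \<xi>. g \<in> carrier G \<Longrightarrow> \<xi> \<in> E \<Longrightarrow> act g \<xi> \<in> E"
  shows "E = points"
proof (rule ev_dense [OF E(1)])
  show "ev ` cosets \<subseteq> E"
    using E(2,3) by (auto elim!: cosetE simp flip: act_base)
qed

theorem flow_samuel: "flow G T Sa act"
  unfolding flow_def
proof (intro conjI)
  show "group_action G (topspace Sa) act"
  proof (rule group_actionI)
    show "act g \<in> extensional (topspace Sa)" for g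
      by (simp add: samuel_act_def)
  qed (simp_all add: act_in_points act_one act_mult)
qed (use base_in_points compact_samuel Hausdorff_samuel continuous_act in auto)

section \<open>Universality of the Samuel compactification\<close>

lemma equivariant_map_determined:
  assumes N: "Hausdorff_space N"
    and f: "equivariant_map G Sa act N \<nu> f" and f': "equivariant_map G Sa act N \<nu> f'"
    and base: "f base = f' base" and \<xi>: "\<xi> \<in> points"
  shows "f \<xi> = f' \<xi>"
proof -
  have "{\<xi> \<in> topspace Sa. f \<xi> = f' \<xi>} = points"
  proof (rule base_dense)
    show "closedin Sa {\<xi> \<in> topspace Sa. f \<xi> = f' \<xi>}"
      using f f' by (intro closedin_continuous_maps_eq [OF N]) (auto simp: equivariant_map_def)
  qed (use f f' base base_in_points act_in_points in \<open>auto simp: equivariant_map_def\<close>)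
  then show ?thesis using \<xi> by blast
qed

text \<open>
  The map must send \<open>\<xi>\<close> to a point \<open>z\<close> such that \<open>F z\<close> equals the value of \<open>\<xi>\<close> at the function
  \<open>g K \<mapsto> F (g n)\<close>, for every continuous real \<open>F\<close> on \<open>N\<close>. The relation \<open>R\<close> of all such pairs is closed.
  Its projection to \<open>Sa\<close> is closed since \<open>N\<close> is compact, and contains the cosets, so it is onto;
  Urysohn functions show that \<open>R\<close> is single-valued. A closed graph in a product with a compact space
  belongs to a continuous map.
\<close>

theorem samuel_universal:
  fixes N :: "'n topology"
  assumes N: "flow G T N \<nu>" and n: "n \<in> topspace N" and fixed: "\<And>h. h \<in> K \<Longrightarrow> \<nu> h n = n"
  obtains \<psi> where "equivariant_map G Sa act N \<nu> \<psi>" "\<psi> base = n"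
proof -
  have cN: "compact_space N" and hN: "Hausdorff_space N"
    using N by (auto simp: flow_def)
  have normal: "normal_space N"
    using cN hN compact_Hausdorff_or_regular_imp_normal_space by blast
  define orb where "orb c = \<nu> (SOME g. g \<in> carrier G \<and> c = g <# K) n" for c
  have orb: "orb (g <# K) = \<nu> g n" if g: "g \<in> carrier G" for g
  proof -
    define g' where "g' = (SOME g'. g' \<in> carrier G \<and> g <# K = g' <# K)"
    have g': "g' \<in> carrier G" "g <# K = g' <# K"
      unfolding g'_def using someI [of "\<lambda>g'. g' \<in> carrier G \<and> g <# K = g' <# K" g] g by auto
    have "g' \<in> g <# K"
      using lcos_self [OF g'(1) K.subgroup_axioms] g'(2) by simp
    then obtain k where k: "k \<in> K" "g' = g \<otimes> k" by (auto simp: l_coset_def)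
    then have "\<nu> g' n = \<nu> g n"
      using flow_mult [OF N g K.mem_carrier n] fixed by simp
    then show ?thesis by (simp add: orb_def g'_def)
  qed
  have orb_in: "orb c \<in> topspace N" if "c \<in> cosets" for c
    using that orb flow_closed [OF N _ n] by (auto elim!: cosetE)
  have orb_translate: "orb (g <# c) = \<nu> g (orb c)" if g: "g \<in> carrier G" and c: "c \<in> cosets" for g c
  proof -
    obtain h where h: "h \<in> carrier G" "c = h <# K" using cosetE [OF c] .
    then show ?thesis
      using orb g flow_mult [OF N g h(1) n] by (simp add: lcos_m_assoc K.subset)
  qed
  define C where "C = {F. continuous_map N euclideanreal F}"
  define hat where "hat F = (\<lambda>c\<in>cosets. complex_of_real (F (orb c)))" for F
  have hat: "hat F \<in> alg" if "F \<in> C" for F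
  proof -
    have F: "continuous_map N euclidean F" using that by (simp add: C_def)
    have "bounded (F ` topspace N)"
      using image_compactin [of N "topspace N" euclidean F] F cN
      by (simp add: compact_space_def compact_imp_bounded)
    then obtain B where B: "\<And>z. z \<in> topspace N \<Longrightarrow> \<bar>F z\<bar> \<le> B"
      by (auto simp: bounded_iff)
    show ?thesis
      unfolding hat_def
    proof (rule algI [where B = B])
      show "cmod (complex_of_real (F (orb c))) \<le> B" if "c \<in> cosets" for c
        using B orb_in [OF that] by simp
      fix \<epsilon> :: real assume "0 < \<epsilon>"
      obtain U where U: "openin T U" "\<one> \<in> U"
          "\<And>u z. u \<in> U \<Longrightarrow> z \<in> topspace N \<Longrightarrow> dist (F (\<nu> u z)) (F z) < \<epsilon>"
        using flow_uniform [OF N F \<open>0 < \<epsilon>\<close>] by metis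
      have "cmod (complex_of_real (F (orb (u <# c))) - complex_of_real (F (orb c))) < \<epsilon>"
        if u: "u \<in> U" and c: "c \<in> cosets" for u c
      proof -
        have "u \<in> carrier G" using openin_carrier [OF U(1)] u by blast
        then show ?thesis
          using U(3) [OF u orb_in [OF c]] c
          by (simp add: orb_translate dist_real_def flip: of_real_diff)
      qed
      then show "\<exists>U. openin T U \<and> \<one> \<in> U \<and> (\<forall>u\<in>U. \<forall>c\<in>cosets.
          cmod (complex_of_real (F (orb (u <# c))) - complex_of_real (F (orb c))) < \<epsilon>)"
        using U(1,2) by blast
    qed
  qed
  define P where "P = prod_topology Sa N"
  have tP: "topspace P = points \<times> topspace N" by (simp add: P_def)
  define R where "R = (\<Inter>F\<in>C. {p \<in> topspace P. complex_of_real (F (snd p)) = fst p (hat F)})"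
  have "(\<lambda>z. 0) \<in> C" by (simp add: C_def)
  have R: "\<xi> \<in> points" "z \<in> topspace N" "F \<in> C \<Longrightarrow> complex_of_real (F z) = \<xi> (hat F)"
    if "(\<xi>, z) \<in> R" for \<xi> z F
    using that \<open>(\<lambda>z. 0) \<in> C\<close> by (auto simp: R_def tP)
  have RI: "(\<xi>, z) \<in> R"
    if "\<xi> \<in> points" "z \<in> topspace N" "\<And>F. F \<in> C \<Longrightarrow> complex_of_real (F z) = \<xi> (hat F)" for \<xi> z
    using that by (auto simp: R_def tP)
  have closedR: "closedin P R"
    unfolding R_def
  proof (rule closedin_INT)
    show "C \<noteq> {}" using \<open>(\<lambda>z. 0) \<in> C\<close> by blast
    fix F assume F: "F \<in> C"
    have "continuous_map P euclidean ((\<lambda>\<xi>. \<xi> (hat F)) \<circ> fst)"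
      unfolding P_def
      by (rule continuous_map_compose [OF continuous_map_fst continuous_map_coordinate [OF hat [OF F]]])
    moreover have "continuous_map N euclidean (complex_of_real \<circ> F)"
      using F by (intro continuous_map_compose [of _ euclidean]) (auto simp: C_def)
    then have "continuous_map P euclidean ((complex_of_real \<circ> F) \<circ> snd)"
      unfolding P_def by (rule continuous_map_compose [OF continuous_map_snd])
    ultimately show "closedin P {p \<in> topspace P. complex_of_real (F (snd p)) = fst p (hat F)}"
      by (intro closedin_continuous_maps_eq [of euclidean]) (auto simp: comp_def)
  qed
  have proj: "closedin Sa (fst ` E)" if "closedin P E" for E
    using Abstract_Topological_Spaces.closed_map_fst [OF cN, of Sa] that
    by (auto simp: closed_map_def P_def)
  have ev_R: "(ev c, orb c) \<in> R" if "c \<in> cosets" for c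
    using that by (intro RI) (auto simp: ev_in_points orb_in ev_apply hat, simp add: hat_def)
  have onto: "fst ` R = points"
  proof (rule ev_dense [OF proj [OF closedR]])
    show "ev ` cosets \<subseteq> fst ` R" using ev_R by force
  qed
  have unique: "z = z'" if z: "(\<xi>, z) \<in> R" and z': "(\<xi>, z') \<in> R" for \<xi> z z'
  proof (rule ccontr)
    assume "z \<noteq> z'"
    have t1: "closedin N {y}" if "y \<in> topspace N" for y
      using hN that by (simp add: closedin_Hausdorff_singleton)
    obtain F where F: "continuous_map N euclideanreal F" "F ` {z} \<subseteq> {0}" "F ` {z'} \<subseteq> {1}"
      using Urysohn_lemma_alt [OF normal t1 [OF R(2) [OF z]] t1 [OF R(2) [OF z']], of 0 1] \<open>z \<noteq> z'\<close>
      by auto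
    have "F \<in> C" using F(1) by (simp add: C_def)
    then have "complex_of_real (F z) = complex_of_real (F z')"
      using R(3) [OF z] R(3) [OF z'] by simp
    then show False using F by simp
  qed
  define \<psi> where "\<psi> \<xi> = (THE z. (\<xi>, z) \<in> R)" for \<xi>
  have \<psi>: "\<psi> \<xi> = z" if "(\<xi>, z) \<in> R" for \<xi> z
    unfolding \<psi>_def using that unique by blast
  have \<psi>R: "(\<xi>, \<psi> \<xi>) \<in> R" if "\<xi> \<in> points" for \<xi>
  proof -
    obtain z where "(\<xi>, z) \<in> R" using \<open>\<xi> \<in> points\<close> onto by (metis imageE prod.collapse)
    then show ?thesis using \<psi> by simp
  qed
  have "continuous_map Sa N \<psi>"
    unfolding continuous_map_closedin
  proof (intro conjI allI impI)
    show "\<psi> \<in> topspace Sa \<rightarrow> topspace N" using R(2) \<psi>R by auto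
    fix E assume E: "closedin N E"
    have "{\<xi> \<in> topspace Sa. \<psi> \<xi> \<in> E} = fst ` (R \<inter> points \<times> E)"
      using \<psi>R \<psi> R(1) by force
    moreover have "closedin P (points \<times> E)"
      using E by (metis P_def closedin_prod_Times_iff closedin_topspace topspace_samuel)
    ultimately show "closedin Sa {\<xi> \<in> topspace Sa. \<psi> \<xi> \<in> E}"
      using proj [OF closedin_Int [OF closedR]] by simp
  qed
  moreover have "\<psi> (act g \<xi>) = \<nu> g (\<psi> \<xi>)" if g: "g \<in> carrier G" and \<xi>: "\<xi> \<in> points" for g \<xi>
  proof (rule \<psi>, rule RI)
    show "act g \<xi> \<in> points" using g \<xi> by (rule act_in_points)
    show "\<nu> g (\<psi> \<xi>) \<in> topspace N" using flow_closed [OF N g] R(2) \<psi>R [OF \<xi>] by blast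
    fix F assume F: "F \<in> C"
    have "F \<circ> \<nu> g \<in> C"
      using F continuous_map_compose [OF flow_continuous_translate [OF N g]] by (simp add: C_def)
    then have "complex_of_real ((F \<circ> \<nu> g) (\<psi> \<xi>)) = \<xi> (hat (F \<circ> \<nu> g))"
      by (rule R(3) [OF \<psi>R [OF \<xi>]])
    also have "hat (F \<circ> \<nu> g) = (\<lambda>c\<in>cosets. hat F (g <# c))"
      unfolding hat_def by (rule restrict_ext) (simp add: g orb_translate translate_coset)
    also have "\<xi> (\<lambda>c\<in>cosets. hat F (g <# c)) = act g \<xi> (hat F)"
      by (rule act_apply [OF \<xi> hat [OF F], symmetric])
    finally show "complex_of_real (F (\<nu> g (\<psi> \<xi>))) = act g \<xi> (hat F)" by simp
  qed
  ultimately have "equivariant_map G Sa act N \<nu> \<psi>" by (simp add: equivariant_map_def)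
  moreover have "\<psi> base = n"
    using \<psi> [OF ev_R [OF base_coset]] orb [OF one_closed] lcos_mult_one [OF K.subset] flow_one [OF N n]
    by (simp add: base_def)
  ultimately show thesis by (rule that)
qed

end

section \<open>Openness of the orbit map on a comeager orbit\<close>

lemma (in Metric_space) geometric_limit:
  assumes "mcomplete" and M: "\<And>n. a n \<in> M" and "0 < e"
    and step: "\<And>n. d (a n) (a (Suc n)) < e / 2 ^ n"
  obtains l where "limitin mtopology a l sequentially" "d (a 0) l \<le> 2 * e"
proof -
  have tail: "d (a n) (a (n + k)) \<le> 2 * (e / 2 ^ n) - 2 * (e / 2 ^ (n + k))" for n k
  proof (induction k)
    case 0
    then show ?case using M by simp
  next
    case (Suc k)
    have "d (a n) (a (n + Suc k)) \<le> d (a n) (a (n + k)) + d (a (n + k)) (a (Suc (n + k)))"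
      using triangle [of "a n" "a (n + k)" "a (Suc (n + k))"] M by simp
    then show ?case using Suc step [of "n + k"] by simp
  qed
  have bound: "d (a n) (a (n + k)) < 2 * (e / 2 ^ n)" for n k
  proof -
    have "0 < e / 2 ^ (n + k)" using \<open>0 < e\<close> by simp
    then show ?thesis using tail [of n k] by linarith
  qed
  have lim0: "(\<lambda>n. 2 * (e / 2 ^ n)) \<longlonglongrightarrow> 0"
    by (intro tendsto_mult_right_zero LIMSEQ_divide_realpow_zero) simp
  have "MCauchy a"
    unfolding MCauchy_def
  proof (intro conjI allI impI)
    show "range a \<subseteq> M" using M by auto
    fix \<epsilon> :: real assume "0 < \<epsilon>"
    then have "\<forall>\<^sub>F n in sequentially. 2 * (e / 2 ^ n) < \<epsilon> / 2"
      using order_tendstoD(2) [OF lim0, of "\<epsilon> / 2"] by simp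
    then obtain N where N: "2 * (e / 2 ^ N) < \<epsilon> / 2" by (auto simp: eventually_sequentially)
    have "d (a n) (a m) < \<epsilon>" if "N \<le> n" "N \<le> m" for n m
    proof -
      have "d (a N) (a n) < \<epsilon> / 2" "d (a N) (a m) < \<epsilon> / 2"
        using bound [of N "n - N"] bound [of N "m - N"] N that by simp_all
      then show ?thesis
        using triangle [of "a n" "a N" "a m"] commute [of "a N" "a n"] M by simp
    qed
    then show "\<exists>N. \<forall>n n'. N \<le> n \<longrightarrow> N \<le> n' \<longrightarrow> d (a n) (a n') < \<epsilon>" by blast
  qed
  then obtain l where l: "limitin mtopology a l sequentially"
    using \<open>mcomplete\<close> by (auto simp: mcomplete_def)
  then have lM: "l \<in> M" using limitin_mspace by blast
  have "d (a 0) l \<le> 2 * e"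
  proof (rule field_le_epsilon)
    fix \<epsilon> :: real assume "0 < \<epsilon>"
    then obtain n where "d (a n) l < \<epsilon>"
      using l unfolding limit_metric_sequentially by blast
    then show "d (a 0) l \<le> 2 * e + \<epsilon>"
      using triangle [of "a 0" "a n" l] M lM bound [of 0 n] by simp
  qed
  with l show thesis by (rule that)
qed

lemma Union_subset_Union_closure:
  assumes "\<And>E. E \<in> \<F> \<Longrightarrow> E \<subseteq> topspace X"
  shows "\<Union>\<F> \<subseteq> \<Union>((closure_of) X ` \<F>)"
proof
  fix y assume "y \<in> \<Union>\<F>"
  then obtain E where "E \<in> \<F>" "y \<in> E" by blast
  with closure_of_subset [OF assms [of E]] show "y \<in> \<Union>((closure_of) X ` \<F>)" by blast
qed

context topological_group
begin

lemma flow_regular_locally_compact: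
  assumes "flow G T X \<alpha>" shows "locally_compact_space X \<and> regular_space X"
  using assms compact_Hausdorff_imp_regular_space compact_imp_locally_compact_space
  by (auto simp: flow_def)

text \<open>
  Compact Hausdorff spaces are Baire.
\<close>

lemma comeager_dense:
  assumes X: "flow G T X \<alpha>" and S: "comeager_in X S"
  shows "X closure_of S = topspace X"
proof -
  obtain \<N> where \<N>: "countable \<N>" "\<And>N. N \<in> \<N> \<Longrightarrow> N \<subseteq> topspace X"
      "\<And>N. N \<in> \<N> \<Longrightarrow> X interior_of (X closure_of N) = {}" "topspace X - S = \<Union>\<N>"
    using S unfolding comeager_in_def meager_in_def by metis
  have "X interior_of (\<Union>((closure_of) X ` \<N>)) = {}"
    using flow_regular_locally_compact [OF X] \<N> by (intro Baire_category_alt) auto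
  moreover have "topspace X - S \<subseteq> \<Union>((closure_of) X ` \<N>)"
    unfolding \<N>(4) by (rule Union_subset_Union_closure [OF \<N>(2)])
  ultimately have "X interior_of (topspace X - S) = {}"
    using interior_of_mono by blast
  then show ?thesis
    by (simp add: interior_of_complement)
       (metis Diff_eq_empty_iff closure_of_subset_topspace subset_antisym)
qed

end

context polish_group
begin

text \<open>
  Countably many translates of \<open>W\<close> cover the separable group, so if \<open>W x\<close> were nowhere dense, the
  orbit would be meager, and with it all of \<open>X\<close>, against Baire's theorem.
\<close>

lemma somewhere_dense_orbit_piece:
  assumes X: "flow G T X \<alpha>" and x: "x \<in> topspace X" and co: "comeager_in X (orbit G \<alpha> x)"
    and W: "openin T W" "W \<noteq> {}"
  shows "X interior_of (X closure_of ((\<lambda>g. \<alpha> g x) ` W)) \<noteq> {}"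
proof
  assume empty: "X interior_of (X closure_of ((\<lambda>g. \<alpha> g x) ` W)) = {}"
  define S where "S = (\<lambda>g. \<alpha> g x) ` W"
  have WG: "W \<subseteq> carrier G" by (rule openin_carrier [OF W(1)])
  then have S: "S \<subseteq> topspace X" using flow_closed [OF X _ x] by (auto simp: S_def)
  obtain D where D: "countable D" "D \<subseteq> carrier G" "T closure_of D = topspace T"
    using separable topspace_eq_carrier by (auto simp: separable_space_def)
  obtain \<N> where \<N>: "countable \<N>" "\<And>N. N \<in> \<N> \<Longrightarrow> N \<subseteq> topspace X"
      "\<And>N. N \<in> \<N> \<Longrightarrow> X interior_of (X closure_of N) = {}" "topspace X - orbit G \<alpha> x = \<Union>\<N>"
    using co unfolding comeager_in_def meager_in_def by metis
  define \<F> where "\<F> = \<N> \<union> (\<lambda>d. \<alpha> d ` S) ` D"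
  have \<F>: "E \<subseteq> topspace X" "X interior_of (X closure_of E) = {}" if E: "E \<in> \<F>" for E
  proof -
    have "E \<subseteq> topspace X \<and> X interior_of (X closure_of E) = {}"
    proof (cases "E \<in> \<N>")
      case False
      then obtain d where "d \<in> D" and "E = \<alpha> d ` S" using E by (auto simp: \<F>_def)
      moreover have "d \<in> carrier G" using \<open>d \<in> D\<close> D(2) by blast
      moreover have "\<alpha> d ` S \<subseteq> topspace X"
        using S flow_closed [OF X \<open>d \<in> carrier G\<close>] by blast
      ultimately show ?thesis
        using flow_interior_closure_image [OF X _ S, of d] empty by (simp add: S_def)
    qed (use \<N> in auto)
    then show "E \<subseteq> topspace X" "X interior_of (X closure_of E) = {}" by auto
  qed
  have "X interior_of (\<Union>((closure_of) X ` \<F>)) = {}"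
    using flow_regular_locally_compact [OF X] \<F> \<N>(1) D(1)
    by (intro Baire_category_alt) (auto simp: \<F>_def)
  moreover have "topspace X \<subseteq> \<Union>((closure_of) X ` \<F>)"
  proof
    fix y assume y: "y \<in> topspace X"
    have "\<exists>E\<in>\<F>. y \<in> E"
    proof (cases "y \<in> orbit G \<alpha> x")
      case True
      then obtain g where g: "g \<in> carrier G" "y = \<alpha> g x" by (auto simp: orbit_def)
      \<comment> \<open>some translate of \<open>W\<close> by an element of \<open>D\<close> contains \<open>g\<close>\<close>
      have "continuous_map T T ((\<lambda>u. u \<otimes> g) \<circ> (\<lambda>u. inv u))"
        by (intro continuous_map_compose [OF continuous_inv] continuous_map_right_mult g)
      then have "openin T {u \<in> carrier G. inv u \<otimes> g \<in> W}" (is "openin T ?V")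
        using openin_preimage [OF _ W(1)] by (simp add: comp_def)
      moreover obtain w where w: "w \<in> W" using W(2) by blast
      then have "g \<otimes> inv w \<in> ?V"
        using g WG by (auto simp: inv_mult_group m_assoc subset_iff)
      ultimately have "D \<inter> ?V \<noteq> {}"
        using D(3) unfolding dense_intersects_open by blast
      then obtain d where d: "d \<in> D" "d \<in> carrier G" "inv d \<otimes> g \<in> W" by blast
      have "y = \<alpha> d (\<alpha> (inv d \<otimes> g) x)"
        using d(2) g x by (simp add: m_assoc [symmetric] flip: flow_mult [OF X])
      then have "y \<in> \<alpha> d ` S" using d(3) by (auto simp: S_def)
      then show ?thesis using d(1) by (auto simp: \<F>_def)
    next
      case False
      then have "y \<in> \<Union>\<N>" using y \<N>(4) by blast
      then show ?thesis by (auto simp: \<F>_def)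
    qed
    then have "y \<in> \<Union>\<F>" by blast
    then show "y \<in> \<Union>((closure_of) X ` \<F>)"
      using Union_subset_Union_closure [of \<F> X, OF \<F>(1)] by blast
  qed
  ultimately have "X interior_of (topspace X) = {}"
    using interior_of_mono by blast
  then show False using x by simp
qed

text \<open>
  The closure-version of openness of the orbit map. For \<open>y = x\<close>, choose \<open>W\<close> with \<open>b W\<inverse> W \<subseteq> N\<close>. As \<open>W x\<close>
  is somewhere dense, the interior of its closure contains some \<open>w x\<close>, and translation by \<open>b w\<inverse>\<close>
  carries this to \<open>b x\<close>. A general \<open>y = k x\<close> reduces to this by replacing \<open>N\<close> with \<open>N k\<close>.
\<close>

lemma orbit_piece_closure_neighbourhood:
  assumes X: "flow G T X \<alpha>" and x: "x \<in> topspace X" and co: "comeager_in X (orbit G \<alpha> x)"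
    and y: "y \<in> orbit G \<alpha> x" and N: "openin T N" "b \<in> N"
  shows "\<alpha> b y \<in> X interior_of (X closure_of ((\<lambda>g. \<alpha> g y) ` N))"
proof -
  have *: "\<alpha> c x \<in> X interior_of (X closure_of ((\<lambda>g. \<alpha> g x) ` L))" if L: "openin T L" "c \<in> L" for L c
  proof -
    have c: "c \<in> carrier G" using openin_carrier [OF L(1)] L(2) by blast
    define U where "U = {u \<in> carrier G. c \<otimes> u \<in> L}"
    have U: "openin T U" "\<one> \<in> U"
      unfolding U_def using openin_preimage [OF continuous_map_left_mult [OF c] L(1)] L(2) c by auto
    obtain W where W: "openin T W" "\<one> \<in> W" "\<And>g h. g \<in> W \<Longrightarrow> h \<in> W \<Longrightarrow> inv g \<otimes> h \<in> U"
      using left_quotient_neighbourhood [OF U] by metis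
    define S where "S = (\<lambda>g. \<alpha> g x) ` W"
    have WG: "W \<subseteq> carrier G" by (rule openin_carrier [OF W(1)])
    then have S: "S \<subseteq> topspace X" using flow_closed [OF X _ x] by (auto simp: S_def)
    have "X interior_of (X closure_of S) \<noteq> {}"
      unfolding S_def using W(2) by (intro somewhere_dense_orbit_piece [OF X x co W(1)]) auto
    then obtain z where "z \<in> X interior_of (X closure_of S)" by blast
    moreover from this have "z \<in> X closure_of S"
      by (rule subsetD [OF interior_of_subset])
    moreover have "openin X (X interior_of (X closure_of S))" by simp
    ultimately have "\<exists>y. y \<in> S \<and> y \<in> X interior_of (X closure_of S)"
      unfolding in_closure_of by (elim conjE allE impE) auto
    then obtain w where w: "w \<in> W" "\<alpha> w x \<in> X interior_of (X closure_of S)"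
      by (auto simp: S_def)
    have wG: "w \<in> carrier G" using w WG by blast
    define k where "k = c \<otimes> inv w"
    have k: "k \<in> carrier G" using c wG by (simp add: k_def)
    have "\<alpha> k (\<alpha> w x) = \<alpha> c x"
      using k wG c x by (simp add: k_def m_assoc flip: flow_mult [OF X])
    moreover have "\<alpha> k (\<alpha> w x) \<in> X interior_of (X closure_of (\<alpha> k ` S))"
      unfolding flow_interior_closure_image [OF X k S] using w(2) by blast
    moreover have "\<alpha> k ` S \<subseteq> (\<lambda>g. \<alpha> g x) ` L"
    proof
      fix z assume "z \<in> \<alpha> k ` S"
      then obtain h where h: "h \<in> W" "z = \<alpha> k (\<alpha> h x)" by (auto simp: S_def)
      then have "z = \<alpha> (c \<otimes> (inv w \<otimes> h)) x"
        using k wG c x WG by (auto simp: k_def m_assoc subset_iff simp flip: flow_mult [OF X])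
      moreover have "c \<otimes> (inv w \<otimes> h) \<in> L" using W(3) [OF w(1) h(1)] by (simp add: U_def)
      ultimately show "z \<in> (\<lambda>g. \<alpha> g x) ` L" by blast
    qed
    then have "X interior_of (X closure_of (\<alpha> k ` S)) \<subseteq> X interior_of (X closure_of ((\<lambda>g. \<alpha> g x) ` L))"
      by (intro interior_of_mono closure_of_mono)
    ultimately show ?thesis by auto
  qed
  obtain k where k: "k \<in> carrier G" "y = \<alpha> k x" using y by (auto simp: orbit_def)
  have NG: "N \<subseteq> carrier G" by (rule openin_carrier [OF N(1)])
  define L where "L = {g \<in> carrier G. g \<otimes> inv k \<in> N}"
  have "openin T L"
    unfolding L_def using k by (intro openin_preimage continuous_map_right_mult N) auto
  moreover have "b \<otimes> k \<in> L" using N(2) NG k by (auto simp: L_def m_assoc subset_iff)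
  ultimately have "\<alpha> (b \<otimes> k) x \<in> X interior_of (X closure_of ((\<lambda>g. \<alpha> g x) ` L))" by (rule *)
  moreover have "\<alpha> (b \<otimes> k) x = \<alpha> b y" using N(2) NG k x flow_mult [OF X] by auto
  moreover have "(\<lambda>g. \<alpha> g x) ` L \<subseteq> (\<lambda>g. \<alpha> g y) ` N"
  proof
    fix z assume "z \<in> (\<lambda>g. \<alpha> g x) ` L"
    then obtain g where g: "g \<in> carrier G" "g \<otimes> inv k \<in> N" "z = \<alpha> g x" by (auto simp: L_def)
    then have "z = \<alpha> (g \<otimes> inv k) y" using k x by (simp add: m_assoc flip: flow_mult [OF X])
    then show "z \<in> (\<lambda>g. \<alpha> g y) ` N" using g(2) by blast
  qed
  then have "X interior_of (X closure_of ((\<lambda>g. \<alpha> g x) ` L))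
      \<subseteq> X interior_of (X closure_of ((\<lambda>g. \<alpha> g y) ` N))"
    by (intro interior_of_mono closure_of_mono)
  ultimately show ?thesis by auto
qed

text \<open>
  The theorem of Effros. Completeness of the group removes the closure in
  \<open>orbit_piece_closure_neighbourhood\<close> by a back-and-forth construction: starting from \<open>\<one>\<close> and \<open>\<one>\<close>,
  one builds Cauchy sequences \<open>a\<^sub>n\<close> and \<open>b\<^sub>n\<close> such that \<open>a\<^sub>n y\<close> lies in the interior of the closure of
  \<open>B(b\<^sub>n, r\<^sub>n) x\<close>, where \<open>r\<^sub>n\<close> tends to \<open>0\<close>. In the limit \<open>a y = b x\<close>, so that \<open>y = a\<inverse> b x\<close> with \<open>a\<close> and
  \<open>b\<close> close to \<open>\<one>\<close>.
\<close>

theorem orbit_map_open: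
  assumes X: "flow G T X \<alpha>" and x: "x \<in> topspace X" and co: "comeager_in X (orbit G \<alpha> x)"
    and U: "openin T U" "\<one> \<in> U"
  obtains V where "openin X V" "x \<in> V" "\<And>y. y \<in> V \<Longrightarrow> y \<in> orbit G \<alpha> x \<Longrightarrow> \<exists>u\<in>U. y = \<alpha> u x"
proof -
  obtain W where W: "openin T W" "\<one> \<in> W" "\<And>g h. g \<in> W \<Longrightarrow> h \<in> W \<Longrightarrow> inv g \<otimes> h \<in> U"
    using left_quotient_neighbourhood [OF U] by metis
  obtain d where d: "Metric_space (carrier G) d" "Metric_space.mcomplete (carrier G) d"
      "T = Metric_space.mtopology (carrier G) d"
    using completely_metrizable topspace_eq_carrier Metric_space.topspace_mtopology
    unfolding completely_metrizable_space_def by metis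
  interpret Metric_space "carrier G" d by (rule d(1))
  obtain s where s: "0 < s" "mball \<one> s \<subseteq> W"
    using W(1,2) unfolding d(3) openin_mtopology by blast
  \<comment> \<open>Both limits are within \<open>2 * e\<close> of \<open>\<one>\<close>, which has to be less than \<open>s\<close>.\<close>
  define e where "e = s / 3"
  define r where "r n = e / 2 ^ n" for n :: nat
  have e: "0 < e" using s by (simp add: e_def)
  have r: "0 < r n" for n using e by (simp add: r_def)
  define I where "I b \<rho> z = X interior_of (X closure_of ((\<lambda>g. \<alpha> g z) ` mball b \<rho>))" for b \<rho> z
  have ball_open: "openin T (mball b \<rho>)" for b \<rho> unfolding d(3) by simp
  have inI: "\<alpha> b z \<in> I b \<rho> z" if "b \<in> carrier G" "0 < \<rho>" "z \<in> orbit G \<alpha> x" for b \<rho> z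
    unfolding I_def using that
    by (intro orbit_piece_closure_neighbourhood [OF X x co _ ball_open]) auto
  \<comment> \<open>One half of a back-and-forth step: the two points exchange their roles, and the tolerance
    \<open>\<sigma>\<close> for the next approximation can be prescribed.\<close>
  have swap: "\<exists>b'\<in>mball b \<rho>. \<alpha> b' w \<in> I a \<sigma> z"
    if "a \<in> carrier G" "0 < \<sigma>" "z \<in> orbit G \<alpha> x" "\<alpha> a z \<in> I b \<rho> w" for a b z w \<rho> \<sigma>
  proof -
    have "\<alpha> a z \<in> X closure_of ((\<lambda>g. \<alpha> g w) ` mball b \<rho>)"
      using that(4) interior_of_subset unfolding I_def by fastforce
    moreover have "openin X (I a \<sigma> z)" by (simp add: I_def)
    ultimately show ?thesis
      using inI [OF that(1-3)] unfolding in_closure_of by blast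
  qed
  have ox: "x \<in> orbit G \<alpha> x" by (rule orbit_invariant(2) [OF X x])
  show thesis
  proof (rule that [of "I \<one> (r 0) x"])
    show "openin X (I \<one> (r 0) x)" by (simp add: I_def)
    show "x \<in> I \<one> (r 0) x"
      using inI [OF one_closed r [of 0] ox] flow_one [OF X x] by simp
    fix y assume y: "y \<in> I \<one> (r 0) x" and oy: "y \<in> orbit G \<alpha> x"
    have yX: "y \<in> topspace X" using orbit_invariant(1) [OF X x] oy by blast
    define P where "P n p \<longleftrightarrow> fst p \<in> carrier G \<and> snd p \<in> carrier G \<and>
        \<alpha> (fst p) y \<in> I (snd p) (r n) x" for n and p :: "'a \<times> 'a"
    define Q where "Q n p q \<longleftrightarrow> d (fst p) (fst q) < r n \<and> d (snd p) (snd q) < r n"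
      for n and p q :: "'a \<times> 'a"
    have next_pair: "\<exists>q. P (Suc n) q \<and> Q n p q" if p: "P n p" for n p
    proof -
      obtain b where b: "b \<in> mball (snd p) (r n)" "\<alpha> b x \<in> I (fst p) (r n) y"
        using p swap [OF _ r oy] unfolding P_def by metis
      have "b \<in> carrier G" using b(1) by auto
      then obtain a where a: "a \<in> mball (fst p) (r n)" "\<alpha> a y \<in> I b (r (Suc n)) x"
        using swap [OF _ r ox b(2)] by blast
      show ?thesis
        using p a b by (intro exI [of _ "(a, b)"]) (auto simp: P_def Q_def)
    qed
    have "P 0 (\<one>, \<one>)" using y flow_one [OF X yX] by (simp add: P_def)
    then obtain f where f: "\<And>n. P n (f n)" "\<And>n. Q n (f n) (f (Suc n))" "f 0 = (\<one>, \<one>)"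
      using dependent_nat_choice [of "\<lambda>n p. P n p \<and> (n = 0 \<longrightarrow> p = (\<one>, \<one>))" Q] next_pair
      by (metis nat.distinct(1))
    obtain a where a: "limitin mtopology (\<lambda>n. fst (f n)) a sequentially" "d \<one> a \<le> 2 * e"
      using geometric_limit [OF d(2) _ e, of "\<lambda>n. fst (f n)"] f by (auto simp: P_def Q_def r_def)
    obtain b where b: "limitin mtopology (\<lambda>n. snd (f n)) b sequentially" "d \<one> b \<le> 2 * e"
      using geometric_limit [OF d(2) _ e, of "\<lambda>n. snd (f n)"] f by (auto simp: P_def Q_def r_def)
    have aG: "a \<in> carrier G" and bG: "b \<in> carrier G" using a(1) b(1) limitin_mspace by blast+
    \<comment> \<open>If the two limits differ, disjoint neighbourhoods of them separate \<open>a\<^sub>n y\<close> from the whole set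
      \<open>B(b\<^sub>n, r\<^sub>n) x\<close> for large \<open>n\<close>.\<close>
    have "\<alpha> a y = \<alpha> b x"
    proof (rule ccontr)
      assume ne: "\<alpha> a y \<noteq> \<alpha> b x"
      obtain A B where AB: "openin X A" "openin X B" "\<alpha> a y \<in> A" "\<alpha> b x \<in> B" "disjnt A B"
        using X ne flow_closed [OF X aG yX] flow_closed [OF X bG x]
        unfolding flow_def Hausdorff_space_def by metis
      have "openin T {g \<in> topspace T. \<alpha> g y \<in> A}" "openin T {g \<in> topspace T. \<alpha> g x \<in> B}"
        by (intro openin_continuous_map_preimage [OF flow_continuous_orbit [OF X]] x yX AB)+
      then obtain \<epsilon> \<epsilon>' where \<epsilon>: "0 < \<epsilon>" "mball a \<epsilon> \<subseteq> {g \<in> topspace T. \<alpha> g y \<in> A}"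
          and \<epsilon>': "0 < \<epsilon>'" "mball b \<epsilon>' \<subseteq> {g \<in> topspace T. \<alpha> g x \<in> B}"
        using aG bG AB(3,4) topspace_eq_carrier unfolding d(3) openin_mtopology
        by (metis (mono_tags, lifting) mem_Collect_eq)
      have "\<forall>\<^sub>F n in sequentially. d (fst (f n)) a < \<epsilon>" "\<forall>\<^sub>F n in sequentially. d (snd (f n)) b < \<epsilon>'/2"
        using a(1) b(1) \<epsilon>(1) half_gt_zero [OF \<epsilon>'(1)]
        unfolding limitin_metric eventually_conj_iff by blast+
      moreover have "r \<longlonglongrightarrow> 0" unfolding r_def by (intro LIMSEQ_divide_realpow_zero) simp
      then have "\<forall>\<^sub>F n in sequentially. r n < \<epsilon>'/2"
        using order_tendstoD(2) half_gt_zero [OF \<epsilon>'(1)] by blast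
      ultimately have "\<forall>\<^sub>F n in sequentially. d (fst (f n)) a < \<epsilon> \<and> d (snd (f n)) b < \<epsilon>'/2 \<and> r n < \<epsilon>'/2"
        by eventually_elim simp
      then obtain n where n: "d (fst (f n)) a < \<epsilon>" "d (snd (f n)) b < \<epsilon>'/2" "r n < \<epsilon>'/2"
        by (auto simp: eventually_sequentially)
      have fn: "fst (f n) \<in> carrier G" "snd (f n) \<in> carrier G" using f(1) [of n] by (auto simp: P_def)
      have "\<alpha> (fst (f n)) y \<in> A"
        using n(1) \<epsilon>(2) fn aG by (auto simp: commute subset_iff)
      moreover have "\<alpha> (fst (f n)) y \<in> X closure_of ((\<lambda>g. \<alpha> g x) ` mball (snd (f n)) (r n))"
        using f(1) [of n] interior_of_subset unfolding P_def I_def by fastforce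
      ultimately obtain g where g: "g \<in> mball (snd (f n)) (r n)" "\<alpha> g x \<in> A"
        using AB(1) unfolding in_closure_of by blast
      then have "d b g < \<epsilon>'"
        using n(2,3) triangle [of b "snd (f n)" g] fn bG by (auto simp: commute)
      then have "\<alpha> g x \<in> B" using \<epsilon>'(2) g(1) bG by (auto simp: subset_iff)
      then show False using g(2) AB(5) by (auto simp: disjnt_def)
    qed
    then have "y = \<alpha> (inv a \<otimes> b) x"
      using aG bG x yX flow_one [OF X yX] flow_mult [OF X, of "inv a"]
      by (metis inv_closed l_inv)
    moreover have "a \<in> W" "b \<in> W"
      using a(2) b(2) aG bG e s(2) by (auto simp: e_def subset_iff)
    ultimately show "\<exists>u\<in>U. y = \<alpha> u x" using W(3) by blast
  qed
qed

end

section \<open>Lifting through extensions\<close>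

context coset_space
begin

text \<open>
  The fibre over \<open>x\<close> is invariant under \<open>K\<close>, so \<open>K\<close> fixes some point \<open>z\<close> of it. The \<open>G\<close>-map sending
  the base point to \<open>z\<close> lifts \<open>\<phi>\<close>, because both sides agree at the base point.
\<close>

lemma extension_lift:
  fixes Z :: "'z topology"
  assumes X: "flow G T X \<alpha>" and x: "x \<in> topspace X" "\<And>h. h \<in> K \<Longrightarrow> \<alpha> h x = x"
    and ea: "extremely_amenable (G\<lparr>carrier := K\<rparr>) (subtopology T K)"
    and \<phi>: "equivariant_map G Sa act X \<alpha> \<phi>" "\<phi> base = x"
    and Z: "flow G T Z \<gamma>" and \<pi>: "extension G Z \<gamma> X \<alpha> \<pi>"
  obtains \<psi> where "equivariant_map G Sa act Z \<gamma> \<psi>" "\<And>\<xi>. \<xi> \<in> points \<Longrightarrow> \<pi> (\<psi> \<xi>) = \<phi> \<xi>"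
proof -
  have \<pi>e: "equivariant_map G Z \<gamma> X \<alpha> \<pi>" and \<pi>s: "\<pi> ` topspace Z = topspace X"
    and \<pi>c: "continuous_map Z X \<pi>"
    using \<pi> by (auto simp: extension_def equivariant_map_def)
  have hX: "Hausdorff_space X" using X by (simp add: flow_def)
  define C where "C = {z \<in> topspace Z. \<pi> z \<in> {x}}"
  have "closedin Z C"
    unfolding C_def using hX x(1)
    by (intro closedin_continuous_map_preimage [OF \<pi>c]) (simp add: closedin_Hausdorff_singleton)
  moreover have "C \<noteq> {}" using x(1) \<pi>s by (force simp: C_def)
  moreover have "\<gamma> h z \<in> C" if h: "h \<in> K" and z: "z \<in> C" for h z
    using z flow_closed [OF Z K.mem_carrier [OF h]] \<pi>e x(2) [OF h] K.mem_carrier [OF h]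
    by (auto simp: C_def equivariant_map_def)
  ultimately obtain z where z: "z \<in> C" "\<And>h. h \<in> K \<Longrightarrow> \<gamma> h z = z"
    using extremely_amenable_fixed_point [OF Z K.subgroup_axioms ea] by metis
  obtain \<psi> where \<psi>: "equivariant_map G Sa act Z \<gamma> \<psi>" "\<psi> base = z"
    using samuel_universal [OF Z _ z(2)] z(1) by (auto simp: C_def)
  show thesis
  proof (rule that [OF \<psi>(1)])
    show "\<pi> (\<psi> \<xi>) = \<phi> \<xi>" if "\<xi> \<in> points" for \<xi>
      using equivariant_map_determined [OF hX equivariant_map_compose [OF \<psi>(1) \<pi>e] \<phi>(1) _ that]
        \<psi>(2) z(1) \<phi>(2) by (simp add: C_def)
  qed
qed

text \<open>
  By irreducibility \<open>\<eta>\<close> is onto, hence an extension, and the identity lifts through it.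
\<close>

lemma irreducible_endomorphism_right_inverse:
  assumes ea: "extremely_amenable (G\<lparr>carrier := K\<rparr>) (subtopology T K)"
    and \<phi>: "irreducible_extension G Sa act X \<alpha> \<phi>"
    and \<eta>: "equivariant_map G Sa act Sa act \<eta>" "\<And>\<xi>. \<xi> \<in> points \<Longrightarrow> \<phi> (\<eta> \<xi>) = \<phi> \<xi>"
  obtains \<zeta> where "equivariant_map G Sa act Sa act \<zeta>" "\<And>\<xi>. \<xi> \<in> points \<Longrightarrow> \<phi> (\<zeta> \<xi>) = \<phi> \<xi>"
    "\<And>\<xi>. \<xi> \<in> points \<Longrightarrow> \<eta> (\<zeta> \<xi>) = \<xi>"
proof -
  have "\<phi> ` \<eta> ` topspace Sa = topspace X"
    using \<phi> \<eta>(2) by (simp add: irreducible_extension_def extension_def image_image)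
  then have "\<eta> ` topspace Sa = topspace Sa"
    by (rule equivariant_map_into_irreducible_surj [OF flow_samuel flow_samuel \<eta>(1) \<phi>])
  then have ext: "extension G Sa act Sa act \<eta>"
    using \<eta>(1) by (simp add: extension_def)
  have id: "equivariant_map G Sa act Sa act (\<lambda>\<xi>. \<xi>)"
    by (simp add: equivariant_map_def)
  have base: "base \<in> topspace Sa" by (simp add: base_in_points)
  obtain \<zeta> where \<zeta>: "equivariant_map G Sa act Sa act \<zeta>" "\<And>\<xi>. \<xi> \<in> points \<Longrightarrow> \<eta> (\<zeta> \<xi>) = \<xi>"
    using extension_lift [OF flow_samuel base act_base_fixed ea id refl flow_samuel ext]
    by metis
  moreover have "\<phi> (\<zeta> \<xi>) = \<phi> \<xi>" if \<xi>: "\<xi> \<in> points" for \<xi>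
  proof -
    have "\<zeta> \<xi> \<in> points"
      using \<zeta>(1) \<xi> continuous_map_image_subset_topspace by (fastforce simp: equivariant_map_def)
    then show ?thesis using \<eta>(2) [of "\<zeta> \<xi>"] \<zeta>(2) [OF \<xi>] by simp
  qed
  ultimately show thesis using that by blast
qed

text \<open>
  In the monoid of endomorphisms over \<open>X\<close> every element has a right inverse, so the monoid is a
  group.
\<close>

lemma irreducible_endomorphism_inj:
  assumes ea: "extremely_amenable (G\<lparr>carrier := K\<rparr>) (subtopology T K)"
    and \<phi>: "irreducible_extension G Sa act X \<alpha> \<phi>"
    and \<eta>: "equivariant_map G Sa act Sa act \<eta>" "\<And>\<xi>. \<xi> \<in> points \<Longrightarrow> \<phi> (\<eta> \<xi>) = \<phi> \<xi>"
  shows "inj_on \<eta> points"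
proof -
  obtain \<zeta> where \<zeta>: "equivariant_map G Sa act Sa act \<zeta>" "\<And>\<xi>. \<xi> \<in> points \<Longrightarrow> \<phi> (\<zeta> \<xi>) = \<phi> \<xi>"
    "\<And>\<xi>. \<xi> \<in> points \<Longrightarrow> \<eta> (\<zeta> \<xi>) = \<xi>"
    using irreducible_endomorphism_right_inverse [OF ea \<phi> \<eta>(1)] \<eta>(2) by metis
  obtain \<omega> where \<omega>: "equivariant_map G Sa act Sa act \<omega>" "\<And>\<xi>. \<xi> \<in> points \<Longrightarrow> \<phi> (\<omega> \<xi>) = \<phi> \<xi>"
    "\<And>\<xi>. \<xi> \<in> points \<Longrightarrow> \<zeta> (\<omega> \<xi>) = \<xi>"
    using irreducible_endomorphism_right_inverse [OF ea \<phi> \<zeta>(1)] \<zeta>(2) by metis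
  have "\<zeta> (\<eta> \<xi>) = \<xi>" if \<xi>: "\<xi> \<in> points" for \<xi>
  proof -
    have "\<omega> \<xi> \<in> points"
      using \<omega>(1) \<xi> continuous_map_image_subset_topspace by (fastforce simp: equivariant_map_def)
    then have "\<eta> \<xi> = \<omega> \<xi>" using \<zeta>(3) [of "\<omega> \<xi>"] \<omega>(3) [OF \<xi>] by simp
    then show ?thesis using \<omega>(3) [OF \<xi>] by simp
  qed
  then show ?thesis by (intro inj_on_inverseI [of _ \<zeta>])
qed

section \<open>Irreducibility over a comeager orbit\<close>

text \<open>
  Suppose finitely many functions \<open>f \<in> F\<close> separate \<open>\<xi>\<close> from \<open>E\<close> with tolerance \<open>\<delta>\<close>. Approximate \<open>\<xi>\<close>
  by a coset \<open>g K\<close> such that \<open>g x\<close> is so close to \<open>x\<close> that \<open>g x = u x\<close>, where \<open>u\<close> moves every \<open>f \<in> F\<close> by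
  less than \<open>\<delta>/2\<close>. Then \<open>h = u\<inverse> g\<close> stabilizes \<open>x\<close>, and \<open>h K\<close> is still within \<open>\<delta>\<close> of \<open>\<xi>\<close>, although it
  belongs to \<open>E\<close>.
\<close>

lemma orbit_fibre_subset_closure:
  assumes P: "polish_group G T" and X: "flow G T X \<alpha>" and x: "x \<in> topspace X"
    and co: "comeager_in X (orbit G \<alpha> x)"
    and \<phi>: "equivariant_map G Sa act X \<alpha> \<phi>" "\<phi> base = x"
    and E: "closedin Sa E" "\<And>h. h \<in> stabilizer G \<alpha> x \<Longrightarrow> act h base \<in> E"
    and \<xi>: "\<xi> \<in> points" "\<phi> \<xi> = x"
  shows "\<xi> \<in> E"
proof (rule ccontr)
  assume "\<xi> \<notin> E"
  interpret P: polish_group G T by (rule P)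
  have "openin Sa (topspace Sa - E)" "\<xi> \<in> topspace Sa - E"
    using E(1) \<xi>(1) \<open>\<xi> \<notin> E\<close> by (auto simp: closedin_def)
  then obtain F \<delta> where F: "finite F" "F \<subseteq> alg" "0 < \<delta>"
    and sep: "\<And>\<eta>. \<eta> \<in> points \<Longrightarrow> (\<And>f. f \<in> F \<Longrightarrow> cmod (\<eta> f - \<xi> f) < \<delta>) \<Longrightarrow> \<eta> \<in> topspace Sa - E"
    using samuel_neighbourhood by metis
  have "\<exists>U. openin T U \<and> \<one> \<in> U \<and> (\<forall>u\<in>U. \<forall>c\<in>cosets. cmod (f (u <# c) - f c) < \<delta>/2)"
    if "f \<in> F" for f
  proof -
    have f: "f \<in> alg" "0 < \<delta>/2" using that F by auto
    show ?thesis by (rule alg_uniform [OF f]) blast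
  qed
  then have "\<forall>f\<in>F. \<exists>U. openin T U \<and> \<one> \<in> U \<and> (\<forall>u\<in>U. \<forall>c\<in>cosets. cmod (f (u <# c) - f c) < \<delta>/2)"
    by blast
  then obtain U where U: "\<forall>f\<in>F. openin T (U f) \<and> \<one> \<in> U f \<and>
      (\<forall>u\<in>U f. \<forall>c\<in>cosets. cmod (f (u <# c) - f c) < \<delta>/2)"
    unfolding bchoice_iff ..
  define U' where "U' = carrier G \<inter> (\<Inter>f\<in>F. U f)"
  have "openin T (topspace T \<inter> \<Inter>(U ` F))"
    using F(1) U by (intro openin_Int_Inter) auto
  then have U': "openin T U'" by (simp add: U'_def topspace_eq_carrier)
  have "\<one> \<in> U'" using U by (simp add: U'_def)
  obtain V where V: "openin X V" "x \<in> V"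
      "\<And>y. y \<in> V \<Longrightarrow> y \<in> orbit G \<alpha> x \<Longrightarrow> \<exists>u\<in>U'. y = \<alpha> u x"
    using P.orbit_map_open [OF X x co U' \<open>\<one> \<in> U'\<close>] by metis
  define W where "W = {\<eta> \<in> topspace Sa. \<phi> \<eta> \<in> V} \<inter> (\<Inter>f\<in>F. {\<eta> \<in> topspace Sa. \<eta> f \<in> ball (\<xi> f) (\<delta>/2)})"
  have oV: "openin Sa {\<eta> \<in> topspace Sa. \<phi> \<eta> \<in> V}"
    using \<phi>(1) by (intro openin_continuous_map_preimage [OF _ V(1)]) (simp add: equivariant_map_def)
  have oF: "openin Sa {\<eta> \<in> topspace Sa. \<eta> f \<in> ball (\<xi> f) (\<delta>/2)}" if "f \<in> F" for f
    using F(2) that by (intro openin_continuous_map_preimage [OF continuous_map_coordinate]) auto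
  have "openin Sa W"
    unfolding W_def
  proof (cases "F = {}")
    case False
    show "openin Sa ({\<eta> \<in> topspace Sa. \<phi> \<eta> \<in> V} \<inter> (\<Inter>f\<in>F. {\<eta> \<in> topspace Sa. \<eta> f \<in> ball (\<xi> f) (\<delta>/2)}))"
      by (intro openin_Int oV openin_INT2 F(1) False oF)
  qed (use oV in simp)
  moreover have "\<xi> \<in> W" using \<xi> V(2) F(3) by (simp add: W_def)
  ultimately have "\<exists>c\<in>cosets. ev c \<in> W"
    using ev_dense [of "topspace Sa - W"] openin_closedin_eq [of Sa W] ev_in_points \<xi>(1) by auto
  then obtain c where c: "c \<in> cosets" "ev c \<in> W" by blast
  then obtain g where g: "g \<in> carrier G" "c = g <# K" using cosetE by blast
  have "\<phi> (ev c) = \<alpha> g x"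
    using \<phi> g base_in_points by (simp add: equivariant_map_def flip: act_base)
  then have "\<alpha> g x \<in> V" using c(2) by (simp add: W_def)
  then obtain u where u: "u \<in> U'" "\<alpha> g x = \<alpha> u x"
    using V(3) g(1) by (auto simp: orbit_def)
  have uG: "u \<in> carrier G" using u(1) by (simp add: U'_def)
  define h where "h = inv u \<otimes> g"
  have hG: "h \<in> carrier G" using uG g by (simp add: h_def)
  have "\<alpha> h x = \<alpha> (inv u) (\<alpha> u x)"
    using uG g x u(2) by (simp add: h_def flow_mult [OF X])
  also have "\<dots> = x"
    using uG x flow_one [OF X x] by (simp flip: flow_mult [OF X])
  finally have "act h base \<in> E"
    using E(2) hG by (simp add: stabilizer_def)
  moreover have "act h base \<in> topspace Sa - E"
  proof (rule sep)
    show "act h base \<in> points" by (rule act_in_points [OF hG base_in_points])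
    fix f assume f: "f \<in> F"
    have "u <# (h <# K) = c"
      using uG g hG by (simp add: h_def lcos_m_assoc K.subset m_assoc [symmetric])
    then have "cmod (f c - f (h <# K)) < \<delta>/2"
      using U f u(1) cosetI [OF hG] by (force simp: U'_def)
    moreover have "dist (\<xi> f) (ev c f) < \<delta>/2"
      using c(2) f by (simp add: W_def)
    then have "cmod (f c - \<xi> f) < \<delta>/2"
      using f F(2) by (simp add: ev_apply subset_iff dist_norm norm_minus_commute)
    ultimately have "cmod (f (h <# K) - \<xi> f) < \<delta>"
      using norm_triangle_ineq4 [of "f c - \<xi> f" "f c - f (h <# K)"] by simp
    then show "cmod (act h base f - \<xi> f) < \<delta>"
      using f F(2) by (simp add: act_base [OF hG] ev_apply subset_iff)
  qed
  ultimately show False by blast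
qed

text \<open>
  The image of \<open>\<rho>\<close> is closed and contains the \<open>H\<close>-orbit of the base point, hence by
  \<open>orbit_fibre_subset_closure\<close> the whole fibre over \<open>x\<close>; and it is minimal, as an image of \<open>M\<close>. A
  subflow that covers \<open>X\<close> meets this fibre, so by minimality it contains the base point.
\<close>

lemma irreducible_over_comeager_orbit:
  assumes P: "polish_group G T" and X: "flow G T X \<alpha>" and x: "x \<in> topspace X"
    and co: "comeager_in X (orbit G \<alpha> x)" and H: "H = stabilizer G \<alpha> x"
    and \<phi>: "equivariant_map G Sa act X \<alpha> \<phi>" "\<phi> base = x"
    and M: "minimal_flow (G\<lparr>carrier := H\<rparr>) (subtopology T H) M \<mu>"
    and \<rho>: "equivariant_map (G\<lparr>carrier := H\<rparr>) M \<mu> Sa act \<rho>" and m: "m \<in> topspace M" "\<rho> m = base"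
  shows "irreducible_extension G Sa act X \<alpha> \<phi>"
  unfolding irreducible_extension_def extension_def
proof (intro conjI allI impI \<phi>(1) notI)
  have \<phi>c: "continuous_map Sa X \<phi>" and \<phi>e: "\<And>g \<xi>. g \<in> carrier G \<Longrightarrow> \<xi> \<in> points \<Longrightarrow> \<phi> (act g \<xi>) = \<alpha> g (\<phi> \<xi>)"
    using \<phi>(1) by (auto simp: equivariant_map_def)
  have fM: "flow (G\<lparr>carrier := H\<rparr>) (subtopology T H) M \<mu>" using M by (simp add: minimal_flow_def)
  have \<rho>c: "continuous_map M Sa \<rho>" and \<rho>e: "\<And>h z. h \<in> H \<Longrightarrow> z \<in> topspace M \<Longrightarrow> \<rho> (\<mu> h z) = act h (\<rho> z)"
    using \<rho> by (auto simp: equivariant_map_def)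
  interpret M: group_action "G\<lparr>carrier := H\<rparr>" "topspace M" \<mu> using fM by (simp add: flow_def)
  have M_closed: "\<mu> h z \<in> topspace M" if "h \<in> H" "z \<in> topspace M" for h z
    using M.element_image [of h z] that by auto
  have "closedin X (\<phi> ` topspace Sa)"
    using image_subflow [OF flow_samuel X \<phi>(1)] by (simp add: subflow_def)
  moreover have "orbit G \<alpha> x \<subseteq> \<phi> ` topspace Sa"
  proof
    fix y assume "y \<in> orbit G \<alpha> x"
    then obtain g where g: "g \<in> carrier G" "y = \<alpha> g x" by (auto simp: orbit_def)
    then have "y = \<phi> (act g base)" using \<phi>e base_in_points \<phi>(2) by simp
    then show "y \<in> \<phi> ` topspace Sa" using act_in_points [OF g(1) base_in_points] by auto
  qed
  ultimately have "X closure_of (orbit G \<alpha> x) \<subseteq> \<phi> ` topspace Sa"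
    by (intro closure_of_minimal)
  moreover have "\<phi> ` topspace Sa \<subseteq> topspace X"
    using continuous_map_image_subset_topspace [OF \<phi>c] .
  ultimately show "\<phi> ` topspace Sa = topspace X"
    using comeager_dense [OF X co] by blast
  fix Z assume Z: "subflow G Sa act Z \<and> Z \<noteq> topspace Sa" and onto: "\<phi> ` Z = topspace X"
  have Zc: "closedin Sa Z" and Zi: "\<And>g \<xi>. g \<in> carrier G \<Longrightarrow> \<xi> \<in> Z \<Longrightarrow> act g \<xi> \<in> Z"
    using Z by (auto simp: subflow_def)
  obtain \<xi> where \<xi>: "\<xi> \<in> Z" "\<phi> \<xi> = x" using x onto by (metis imageE)
  have "\<xi> \<in> points" using closedin_subset [OF Zc] \<xi>(1) by auto
  have HG: "H \<subseteq> carrier G" by (auto simp: H stabilizer_def)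
  have closed: "closedin Sa (\<rho> ` topspace M)"
    using continuous_imp_closed_map [OF \<rho>c] fM Hausdorff_samuel by (auto simp: flow_def closed_map_def)
  have inM: "act h base \<in> \<rho> ` topspace M" if "h \<in> stabilizer G \<alpha> x" for h
    using \<rho>e [of h m] M_closed [of h m] m that H by (metis imageI)
  have "\<xi> \<in> \<rho> ` topspace M"
    by (rule orbit_fibre_subset_closure [where \<phi> = \<phi> and \<xi> = \<xi> and x = x, OF P X x co \<phi> closed _ \<open>\<xi> \<in> points\<close> \<xi>(2)])
      (rule inM)
  then obtain z where z: "z \<in> topspace M" "\<rho> z = \<xi>" by blast
  define E where "E = {w \<in> topspace M. \<rho> w \<in> Z}"
  have "closedin M E" unfolding E_def by (rule closedin_continuous_map_preimage [OF \<rho>c Zc])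
  moreover have "orbit (G\<lparr>carrier := H\<rparr>) \<mu> z \<subseteq> E"
    using z \<xi>(1) M_closed \<rho>e Zi HG by (auto simp: orbit_def E_def)
  ultimately have "M closure_of (orbit (G\<lparr>carrier := H\<rparr>) \<mu> z) \<subseteq> E" by (intro closure_of_minimal)
  then have "m \<in> E" using M z(1) m(1) by (auto simp: minimal_flow_def)
  then have "base \<in> Z" using m(2) by (simp add: E_def)
  then have "Z = points" by (intro base_dense [OF Zc] Zi)
  then show False using Z by simp
qed

end

section \<open>The projective cover\<close>

theorem theorem3p18:
  fixes G :: "('g, 'b) monoid_scheme" and T :: "'g topology"
    and X :: "'x topology" and \<alpha> :: "'g \<Rightarrow> 'x \<Rightarrow> 'x"
    and M :: "'m topology" and \<mu> :: "'g \<Rightarrow> 'm \<Rightarrow> 'm"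
    and Y :: "'y topology" and \<beta> :: "'g \<Rightarrow> 'y \<Rightarrow> 'y"
  assumes "polish_group G T"
    and "flow G T X \<alpha>"
    and "point_transitive G X \<alpha>"
    and "x \<in> topspace X"
    and "comeager_in X (orbit G \<alpha> x)"
    and "H = stabilizer G \<alpha> x"
    and "universal_minimal_flow (G\<lparr>carrier := H\<rparr>) (subtopology T H) M \<mu>"
    and "\<exists>m\<in>topspace M. comeager_in M (orbit (G\<lparr>carrier := H\<rparr>) \<mu> m)"
    and "subgroup Hs (G\<lparr>carrier := H\<rparr>)"
    and "closedin (subtopology T H) Hs"
    and "extremely_amenable (G\<lparr>carrier := Hs\<rparr>) (subtopology T Hs)"
    and "flow_isomorphic (G\<lparr>carrier := H\<rparr>) M \<mu>
           (samuel (G\<lparr>carrier := H\<rparr>) (subtopology T H) Hs)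
           (samuel_act (G\<lparr>carrier := H\<rparr>) (subtopology T H) Hs)"
  shows "projective_cover G T (samuel G T Hs) (samuel_act G T Hs) X \<alpha> \<and>
    (projective_cover G T Y \<beta> X \<alpha> \<longrightarrow>
       flow_isomorphic G Y \<beta> (samuel G T Hs) (samuel_act G T Hs))"
proof -
  note X = assms(2) and x = assms(4) and co = assms(5) and H = assms(6) and ea = assms(11)
  interpret polish_group G T by (rule assms(1))
  interpret X: group_action G "topspace X" \<alpha> using X by (simp add: flow_def)
  have HG: "subgroup H G" unfolding H by (rule X.stabilizer_subgroup [OF x])
  have HsG: "subgroup Hs G" using incl_subgroup [OF HG assms(9)] .
  have HsH: "Hs \<subseteq> H" using subgroup.subset [OF assms(9)] by simp
  interpret S: coset_space G T Hs
    by (intro coset_space.intro topological_group_axioms HsG)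
  interpret R: coset_space "G\<lparr>carrier := H\<rparr>" "subtopology T H" Hs
    by (intro coset_space.intro topological_subgroup HG assms(9))
  have fixed: "\<alpha> h x = x" if "h \<in> Hs" for h
    using HsH that by (auto simp: H stabilizer_def)
  obtain \<phi> where \<phi>: "equivariant_map G S.Sa S.act X \<alpha> \<phi>" "\<phi> S.base = x"
    by (rule S.samuel_universal [OF X x fixed])
  have act_in: "S.act h \<xi> \<in> S.points" if "h \<in> H" "\<xi> \<in> S.points" for h \<xi>
    using that subgroup.mem_carrier [OF HG] S.act_in_points by blast
  have "flow (G\<lparr>carrier := H\<rparr>) (subtopology T H) (subtopology S.Sa (topspace S.Sa))
      (\<lambda>g. restrict (S.act g) (topspace S.Sa))"
    by (rule restricted_flow [OF S.flow_samuel HG])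
      (use act_in S.base_in_points closedin_topspace [of S.Sa] in auto)
  moreover have "(\<lambda>g. restrict (S.act g) (topspace S.Sa)) = S.act"
    by (simp add: samuel_act_def fun_eq_iff)
  ultimately have fS: "flow (G\<lparr>carrier := H\<rparr>) (subtopology T H) S.Sa S.act"
    by (simp only: subtopology_topspace)
  \<comment> \<open>As an \<open>H\<close>-flow, \<open>Sa(G/Hs)\<close> has the \<open>Hs\<close>-fixed base point, so universality of \<open>Sa(H/Hs)\<close> provides
    the comparison map. Composed with \<open>M \<simeq> Sa(H/Hs)\<close> it is the required map from a minimal flow.\<close>
  obtain r where r: "equivariant_map (G\<lparr>carrier := H\<rparr>) R.Sa R.act S.Sa S.act r" "r R.base = S.base"
    by (rule R.samuel_universal [OF fS, of S.base]) (simp_all add: S.base_in_points S.act_base_fixed)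
  obtain f where f: "homeomorphic_map M R.Sa f" "equivariant_map (G\<lparr>carrier := H\<rparr>) M \<mu> R.Sa R.act f"
    using assms(12) by (auto simp: flow_isomorphic_def)
  have "f ` topspace M = R.points"
    using homeomorphic_imp_surjective_map [OF f(1)] by simp
  then obtain m where m: "m \<in> topspace M" "f m = R.base"
    using R.base_in_points by (metis imageE)
  have irr: "irreducible_extension G S.Sa S.act X \<alpha> \<phi>"
    by (rule S.irreducible_over_comeager_orbit [OF assms(1) X x co H \<phi> _
          equivariant_map_compose [OF f(2) r(1)] m(1)])
      (use assms(7) m r in \<open>auto simp: universal_minimal_flow_def\<close>)
  have lift: "\<exists>\<psi>. equivariant_map G S.Sa S.act Z \<gamma> \<psi> \<and> (\<forall>\<xi>\<in>topspace S.Sa. \<pi> (\<psi> \<xi>) = \<phi> \<xi>)"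
    if "flow G T Z \<gamma>" "irreducible_extension G Z \<gamma> X \<alpha> \<pi>"
    for Z :: "('g \<times> 'x) set set topology" and \<gamma> \<pi>
    by (rule S.extension_lift [OF X x fixed ea \<phi> that(1), of \<pi>])
      (use that(2) in \<open>auto simp: irreducible_extension_def\<close>)
  have cover: "projective_cover G T S.Sa S.act X \<alpha>"
    using S.flow_samuel irr lift unfolding projective_cover_def projective_cover_map_def by blast
  have "flow_isomorphic G Y \<beta> S.Sa S.act" if Y: "projective_cover G T Y \<beta> X \<alpha>"
  proof -
    obtain \<kappa> where fY: "flow G T Y \<beta>" and \<kappa>: "projective_cover_map G T Y \<beta> X \<alpha> \<kappa>"
      using Y by (auto simp: projective_cover_def)
    have irrY: "irreducible_extension G Y \<beta> X \<alpha> \<kappa>" using \<kappa> by (simp add: projective_cover_map_def)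
    have extY: "extension G Y \<beta> X \<alpha> \<kappa>" using irrY by (simp add: irreducible_extension_def)
    obtain \<psi> where \<psi>: "equivariant_map G S.Sa S.act Y \<beta> \<psi>" "\<And>\<xi>. \<xi> \<in> S.points \<Longrightarrow> \<kappa> (\<psi> \<xi>) = \<phi> \<xi>"
      using S.extension_lift [OF X x fixed ea \<phi> fY extY] by metis
    obtain \<theta> where \<theta>: "equivariant_map G Y \<beta> S.Sa S.act \<theta>" "\<And>y. y \<in> topspace Y \<Longrightarrow> \<phi> (\<theta> y) = \<kappa> y"
      using projective_cover_mapD [OF \<kappa> topspace_eq_carrier S.flow_samuel irr] by blast
    have \<psi>_in: "\<psi> \<xi> \<in> topspace Y" if "\<xi> \<in> S.points" for \<xi>
      using \<psi>(1) that continuous_map_image_subset_topspace by (fastforce simp: equivariant_map_def)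
    have onto: "\<psi> ` topspace S.Sa = topspace Y"
    proof (rule equivariant_map_into_irreducible_surj [OF S.flow_samuel fY \<psi>(1) irrY])
      show "\<kappa> ` \<psi> ` topspace S.Sa = topspace X"
        using irr \<psi>(2) by (simp add: irreducible_extension_def extension_def image_image)
    qed
    have inj: "inj_on (\<theta> \<circ> \<psi>) S.points"
      by (rule S.irreducible_endomorphism_inj [OF ea irr equivariant_map_compose [OF \<psi>(1) \<theta>(1)]])
        (simp add: \<theta>(2) \<psi>(2) \<psi>_in)
    have "\<theta> ` topspace Y = topspace S.Sa"
    proof (rule equivariant_map_into_irreducible_surj [OF fY S.flow_samuel \<theta>(1) irr])
      show "\<phi> ` \<theta> ` topspace Y = topspace X"
        using extY \<theta>(2) by (simp add: extension_def image_image)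
    qed
    moreover have "inj_on \<theta> (topspace Y)"
      using inj onto by (metis S.topspace_samuel inj_on_imageI)
    moreover have "continuous_map Y S.Sa \<theta>" using \<theta>(1) by (simp add: equivariant_map_def)
    ultimately have "homeomorphic_map Y S.Sa \<theta>"
      using fY S.Hausdorff_samuel
      by (intro continuous_imp_homeomorphic_map) (auto simp: flow_def)
    then show ?thesis using \<theta>(1) by (auto simp: flow_isomorphic_def)
  qed
  with cover show ?thesis by blast
qed

end
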